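(* Let $p$ be a prime, let $M,N\ge 0$ be integers, and let $S\subset\mathbb{Q}_p$ be a scaling set whose corresponding scaling function $\phi$ (so $\hat\phi(\xi)=\mathds{1}_S(\xi)$ for every $\xi\in\mathbb{Q}_p$) belongs to $\mathcal{D}_N^M$. Suppose that there are at most $p^N$ integers in $p^{M}S\cap[0,p^{M+N}-1]$, i.e. at most $p^N$ integers $n$ with $0\le n\le p^{M+N}-1$ and $n\in p^MS$. Then for every $b\in\mathbb{Q}_p$, $$\sum_{a\in I_p}\alpha_{a,b}\,\chi_p((a-b)\xi)=1\qquad\text{for all }\xi\in S,$$ where $(\alpha_{a,b})_{a\in I_p}$ are the complex coefficients in the expansion $\phi(x-b)=\sum_{a\in I_p}\alpha_{a,b}\,\phi(x-a)$ of the translate $\phi(\cdot-b)$ in the orthonormal system $\{\phi(\cdot-a):a\in I_p\}$.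
   Context: $\mathbb{Q}_p$ is the field of $p$-adic numbers, with norm $|\cdot|_p$ and ring of integers $\mathbb{Z}_p=\{x:|x|_p\le 1\}$. The Haar measure $dx$ is normalized by $\int_{\mathbb{Z}_p}dx=1$. $B_\gamma(c)=\{x:|x-c|_p\le p^\gamma\}$. For $x=\sum_{j\ge\gamma}x_jp^j$ with digits $x_j\in\{0,\dots,p-1\}$, the fractional part is $\{x\}_p=\sum_{j=\gamma}^{-1}x_jp^j$ (and $\{x\}_p=0$ if $x=0$ or $\gamma\ge 0$). $I_p=\{x\in\mathbb{Q}_p:\{x\}_p=x\}$. $\chi_p(x)=e^{2\pi i\{x\}_p}$. The Fourier transform on $L^2(\mathbb{Q}_p)$ is the unitary extension of $\hat f(\xi)=\int_{\mathbb{Q}_p}\chi_p(\xi x)f(x)\,dx$, with inverse $\check f(\xi)=\int_{\mathbb{Q}_p}\chi_p(-\xi x)f(x)\,dx$. For $A\subset\mathbb{Q}_p$, $p^jA=\{p^ja:a\in A\}$, and $\mathds{1}_A$ is the characteristic function of $A$. $\mathcal{D}_N^M$ is the set of locally constant functions $f:\mathbb{Q}_p\to\mathbb{C}$ that are $p^M$-periodic ($f(x+p^M)=f(x)$) and supported on $B_N(0)$. MRA: a collection of closed subspaces $V_j\subset L^2(\mathbb{Q}_p)$, $j\in\mathbb{Z}$, is a multiresolution analysis if (i) $V_j\subset V_{j+1}$ for all $j$; (ii) $\bigcup_jV_j$ is dense in $L^2(\mathbb{Q}_p)$; (iii) $\bigcap_jV_j=\{0\}$; (iv) $f(\cdot)\in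 V_j\iff f(p^{-1}\cdot)\in V_{j+1}$ for all $j$; (v) there is $\phi\in V_0$, called a scaling function of the MRA, such that $\{\phi(\cdot-a):a\in I_p\}$ is an orthonormal basis of $V_0$. Scaling set: a measurable set $S\subset\mathbb{Q}_p$ is a scaling set if $\check{\mathds{1}}_S$ is a scaling function of an MRA in $L^2(\mathbb{Q}_p)$; the corresponding scaling function is $\phi=\check{\mathds{1}}_S$. *)

theory Defs
  imports "HOL-Analysis.Analysis" "Berlekamp_Zassenhaus.Finite_Field"
begin

section \<open>The \<open>p\<close>-adic absolute value on the rationals\<close>

definition padic_abs :: "nat \<Rightarrow> rat \<Rightarrow> real" where
  "padic_abs p x = (if x = 0 then 0 else
     (case quotient_of x of (a, b) \<Rightarrow>
        real p powi (int (multiplicity (int p) b) - int (multiplicity (int p) a))))"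

lemma padic_abs_fraction:
  assumes p: "prime p" and a: "a \<noteq> 0" and b: "b \<noteq> 0"
  shows "padic_abs p (of_int a / of_int b) =
           real p powi (int (multiplicity (int p) b) - int (multiplicity (int p) a))"
proof -
  have pe: "prime_elem (int p)" using p by simp
  obtain c d where q: "quotient_of (of_int a / of_int b) = (c, d)" by fastforce
  have d: "d > 0" using quotient_of_denom_pos[OF q] .
  have eq: "(of_int a / of_int b :: rat) = of_int c / of_int d" using quotient_of_div[OF q] .
  have c: "c \<noteq> 0" using eq a b d by auto
  have "(of_int (a * d) :: rat) = of_int (c * b)"
    using eq b d by (simp add: field_simps)
  then have "a * d = c * b" by (simp only: of_int_eq_iff)
  then have "multiplicity (int p) a + multiplicity (int p) d
           = multiplicity (int p) c + multiplicity (int p) b"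
    using prime_elem_multiplicity_mult_distrib[OF pe] a b c d by (metis less_irrefl)
  then have "int (multiplicity (int p) b) - int (multiplicity (int p) a)
           = int (multiplicity (int p) d) - int (multiplicity (int p) c)" by linarith
  then show ?thesis using a b by (simp add: padic_abs_def q)
qed

lemma rat_fraction: obtains a b where "(x::rat) = of_int a / of_int b" "b > 0"
  by (metis quotient_of_denom_pos quotient_of_div surj_pair)

lemma padic_abs_0 [simp]: "padic_abs p 0 = 0"
  by (simp add: padic_abs_def)

lemma padic_abs_1 [simp]: "padic_abs p 1 = 1"
  by (simp add: padic_abs_def)

lemma padic_abs_nonneg: "padic_abs p x \<ge> 0"
  by (simp add: padic_abs_def split: prod.split)

lemma padic_abs_eq_0: "prime p \<Longrightarrow> padic_abs p x = 0 \<longleftrightarrow> x = 0"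
  by (auto simp: padic_abs_def prime_gt_0_nat split: prod.splits if_splits)

lemma padic_abs_mult:
  assumes p: "prime p"
  shows "padic_abs p (x * y) = padic_abs p x * padic_abs p y"
proof (cases "x = 0 \<or> y = 0")
  case False
  obtain a b where x: "x = of_int a / of_int b" "b > 0" by (rule rat_fraction)
  obtain c d where y: "y = of_int c / of_int d" "d > 0" by (rule rat_fraction)
  have nz: "a \<noteq> 0" "c \<noteq> 0" "b \<noteq> 0" "d \<noteq> 0" using x y False by auto
  have pe: "prime_elem (int p)" using p by simp
  have p0: "real p \<noteq> 0" using p by auto
  have "x * y = of_int (a * c) / of_int (b * d)" by (simp add: x y)
  then have "padic_abs p (x * y) =
      real p powi (int (multiplicity (int p) (b * d)) - int (multiplicity (int p) (a * c)))"
    using padic_abs_fraction[OF p, of "a * c" "b * d"] nz by simp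
  also have "\<dots> = real p powi ((int (multiplicity (int p) b) - int (multiplicity (int p) a))
        + (int (multiplicity (int p) d) - int (multiplicity (int p) c)))"
    using nz by (simp add: prime_elem_multiplicity_mult_distrib[OF pe] algebra_simps)
  also have "\<dots> = padic_abs p x * padic_abs p y"
    using nz p0 by (simp add: power_int_add x y padic_abs_fraction[OF p])
  finally show ?thesis .
qed auto

lemma padic_abs_ultrametric:
  assumes p: "prime p"
  shows "padic_abs p (x + y) \<le> max (padic_abs p x) (padic_abs p y)"
proof (cases "x = 0 \<or> y = 0 \<or> x + y = 0")
  case True
  then show ?thesis using padic_abs_nonneg[of p] by (auto simp: max_def)
next
  case False
  obtain a b where x: "x = of_int a / of_int b" "b > 0" by (rule rat_fraction)
  obtain c d where y: "y = of_int c / of_int d" "d > 0" by (rule rat_fraction)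
  define u v e where "u = a * d" and "v = c * b" and "e = b * d"
  have e: "e \<noteq> 0" using x y by (simp add: e_def)
  have xe: "x = of_int u / of_int e" and ye: "y = of_int v / of_int e"
    using x y by (simp_all add: u_def v_def e_def)
  have xye: "x + y = of_int (u + v) / of_int e" by (simp add: xe ye add_divide_distrib)
  have nz: "u \<noteq> 0" "v \<noteq> 0" "u + v \<noteq> 0" using False xe ye xye by auto
  let ?m = "multiplicity (int p)"
  have nu: "\<not> is_unit (int p)" using p by auto
  have "int p ^ min (?m u) (?m v) dvd u" "int p ^ min (?m u) (?m v) dvd v"
    by (auto intro: multiplicity_dvd')
  then have "int p ^ min (?m u) (?m v) dvd u + v" by simp
  then have "min (?m u) (?m v) \<le> ?m (u + v)"
    using multiplicity_geI nz(3) nu by blast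
  then have "int (?m e) - int (?m (u + v)) \<le> int (?m e) - int (?m u) \<or>
      int (?m e) - int (?m (u + v)) \<le> int (?m e) - int (?m v)" by linarith
  moreover have "1 \<le> real p" using p prime_gt_0_nat[of p] by linarith
  ultimately have "padic_abs p (of_int (u + v) / of_int e) \<le> padic_abs p (of_int u / of_int e) \<or>
      padic_abs p (of_int (u + v) / of_int e) \<le> padic_abs p (of_int v / of_int e)"
    unfolding padic_abs_fraction[OF p nz(1) e] padic_abs_fraction[OF p nz(2) e]
      padic_abs_fraction[OF p nz(3) e]
    using power_int_increasing by blast
  then show ?thesis unfolding xye unfolding xe ye by (simp only: le_max_iff_disj)
qed

lemma padic_abs_minus: assumes "prime p" shows "padic_abs p (- x) = padic_abs p x"
proof -
  have "padic_abs p (-1) * padic_abs p (-1) = 1"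
    using padic_abs_mult[OF assms, of "-1" "-1"] by simp
  then have "padic_abs p (-1) = 1"
    using padic_abs_nonneg[of p "-1"] by (metis abs_of_nonneg abs_1 power2_eq_square real_sqrt_abs real_sqrt_one)
  then show ?thesis using padic_abs_mult[OF assms, of "-1" x] by simp
qed

lemma padic_abs_triangle:
  assumes "prime p" shows "padic_abs p (x + y) \<le> padic_abs p x + padic_abs p y"
  using padic_abs_ultrametric[OF assms, of x y] padic_abs_nonneg[of p x] padic_abs_nonneg[of p y]
  by linarith

lemma padic_abs_diff_triangle:
  assumes "prime p" shows "\<bar>padic_abs p x - padic_abs p y\<bar> \<le> padic_abs p (x - y)"
  using padic_abs_triangle[OF assms, of "x - y" y] padic_abs_triangle[OF assms, of "y - x" x]
    padic_abs_minus[OF assms, of "x - y"] by simp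

lemma padic_abs_inverse:
  assumes "prime p" shows "padic_abs p (inverse x) = inverse (padic_abs p x)"
proof (cases "x = 0")
  case False
  then have "padic_abs p (inverse x) * padic_abs p x = 1"
    by (simp flip: padic_abs_mult[OF assms])
  then show ?thesis by (metis inverse_unique mult.commute)
qed auto


section \<open>The field of \<open>p\<close>-adic numbers\<close>

text \<open>
  \<open>\<rat>\<^sub>p\<close> is the completion of \<open>\<rat>\<close> with respect to the \<open>p\<close>-adic absolute value. The prime is
  the cardinality of the type argument \<open>'p\<close>; a free type variable of class \<open>prime_card\<close>
  thus amounts to an arbitrary prime.
\<close>

definition padic_cauchy :: "nat \<Rightarrow> (nat \<Rightarrow> rat) \<Rightarrow> bool" where
  "padic_cauchy p X \<longleftrightarrow> (\<forall>e>0. \<exists>k. \<forall>m\<ge>k. \<forall>n\<ge>k. padic_abs p (X m - X n) < e)"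

definition padic_null :: "nat \<Rightarrow> (nat \<Rightarrow> rat) \<Rightarrow> bool" where
  "padic_null p X \<longleftrightarrow> (\<lambda>n. padic_abs p (X n)) \<longlonglongrightarrow> 0"

lemma padic_null_const: "prime p \<Longrightarrow> padic_null p (\<lambda>n. c) \<longleftrightarrow> c = 0"
  by (simp add: padic_null_def LIMSEQ_const_iff padic_abs_eq_0)

lemma padic_null_bound:
  assumes "(\<lambda>n. f n) \<longlonglongrightarrow> 0" "eventually (\<lambda>n. padic_abs p (X n) \<le> f n) sequentially"
  shows "padic_null p X"
  unfolding padic_null_def
  by (rule tendsto_sandwich[of "\<lambda>_. 0" _ _ f]) (use assms in \<open>auto simp: padic_abs_nonneg\<close>)

lemma padic_null_add:
  assumes p: "prime p" and "padic_null p X" "padic_null p Y"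
  shows "padic_null p (\<lambda>n. X n + Y n)"
proof (rule padic_null_bound)
  show "(\<lambda>n. padic_abs p (X n) + padic_abs p (Y n)) \<longlonglongrightarrow> 0"
    using assms tendsto_add_zero unfolding padic_null_def by blast
qed (simp add: padic_abs_triangle[OF p])

lemma padic_null_minus: "prime p \<Longrightarrow> padic_null p (\<lambda>n. - X n) \<longleftrightarrow> padic_null p X"
  by (simp add: padic_null_def padic_abs_minus)

lemma padic_cauchy_const [simp]: "padic_cauchy p (\<lambda>n. c)"
  by (simp add: padic_cauchy_def)

lemma padic_cauchy_uminus:
  assumes p: "prime p" and X: "padic_cauchy p X"
  shows "padic_cauchy p (\<lambda>n. - X n)"
proof -
  have "padic_abs p (- X m - - X n) = padic_abs p (X m - X n)" for m n
    using padic_abs_minus[OF p, of "X m - X n"] by simp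
  then show ?thesis using X by (simp add: padic_cauchy_def)
qed

lemma padic_cauchy_add:
  assumes p: "prime p" and X: "padic_cauchy p X" and Y: "padic_cauchy p Y"
  shows "padic_cauchy p (\<lambda>n. X n + Y n)"
  unfolding padic_cauchy_def
proof (intro allI impI)
  fix e :: real assume "e > 0"
  then obtain k l where k: "\<forall>m\<ge>k. \<forall>n\<ge>k. padic_abs p (X m - X n) < e"
    and l: "\<forall>m\<ge>l. \<forall>n\<ge>l. padic_abs p (Y m - Y n) < e"
    using X Y unfolding padic_cauchy_def by meson
  have "padic_abs p (X m + Y m - (X n + Y n)) < e" if "m \<ge> max k l" "n \<ge> max k l" for m n
  proof -
    have "padic_abs p (X m + Y m - (X n + Y n)) \<le> max (padic_abs p (X m - X n)) (padic_abs p (Y m - Y n))"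
      using padic_abs_ultrametric[OF p, of "X m - X n" "Y m - Y n"] by (simp add: algebra_simps)
    also have "\<dots> < e" using k l that by simp
    finally show ?thesis .
  qed
  then show "\<exists>k. \<forall>m\<ge>k. \<forall>n\<ge>k. padic_abs p (X m + Y m - (X n + Y n)) < e" by blast
qed

lemma padic_cauchy_abs:
  assumes p: "prime p" and X: "padic_cauchy p X"
  shows "convergent (\<lambda>n. padic_abs p (X n))"
proof -
  have "Cauchy (\<lambda>n. padic_abs p (X n))"
  proof (rule metric_CauchyI)
    fix e :: real assume "e > 0"
    then obtain k where "\<forall>m\<ge>k. \<forall>n\<ge>k. padic_abs p (X m - X n) < e"
      using X unfolding padic_cauchy_def by meson
    then show "\<exists>M. \<forall>m\<ge>M. \<forall>n\<ge>M. dist (padic_abs p (X m)) (padic_abs p (X n)) < e"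
      unfolding dist_real_def using padic_abs_diff_triangle[OF p] by (meson le_less_trans)
  qed
  then show ?thesis by (simp add: Cauchy_convergent_iff)
qed

lemma padic_cauchy_bounded:
  assumes p: "prime p" and X: "padic_cauchy p X"
  obtains B where "B > 0" "\<And>n. padic_abs p (X n) \<le> B"
proof -
  obtain L where "(\<lambda>n. padic_abs p (X n)) \<longlonglongrightarrow> L"
    using padic_cauchy_abs[OF p X] convergent_def by blast
  then have "Bseq (\<lambda>n. padic_abs p (X n))" using convergentI convergent_imp_Bseq by blast
  then show ?thesis using that padic_abs_nonneg
    unfolding Bseq_def by (metis abs_of_nonneg real_norm_def)
qed

lemma padic_null_mult:
  assumes p: "prime p" and X: "padic_cauchy p X" and Y: "padic_null p Y"
  shows "padic_null p (\<lambda>n. X n * Y n)"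
proof -
  obtain B where B: "B > 0" "\<And>n. padic_abs p (X n) \<le> B" using padic_cauchy_bounded[OF p X] by blast
  show ?thesis
  proof (rule padic_null_bound)
    show "(\<lambda>n. B * padic_abs p (Y n)) \<longlonglongrightarrow> 0"
      using Y unfolding padic_null_def by (rule tendsto_mult_right_zero)
    show "\<forall>\<^sub>F n in sequentially. padic_abs p (X n * Y n) \<le> B * padic_abs p (Y n)"
      by (intro always_eventually allI)
        (simp add: padic_abs_mult[OF p] B mult_right_mono padic_abs_nonneg)
  qed
qed

lemma padic_cauchy_mult:
  assumes p: "prime p" and X: "padic_cauchy p X" and Y: "padic_cauchy p Y"
  shows "padic_cauchy p (\<lambda>n. X n * Y n)"
  unfolding padic_cauchy_def
proof (intro allI impI)
  fix e :: real assume e: "e > 0"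
  obtain A where A: "A > 0" "\<And>n. padic_abs p (X n) \<le> A" using padic_cauchy_bounded[OF p X] by blast
  obtain B where B: "B > 0" "\<And>n. padic_abs p (Y n) \<le> B" using padic_cauchy_bounded[OF p Y] by blast
  have "e / B > 0" "e / A > 0" using e A B by simp_all
  then obtain k l where k: "\<forall>m\<ge>k. \<forall>n\<ge>k. padic_abs p (X m - X n) < e / B"
    and l: "\<forall>m\<ge>l. \<forall>n\<ge>l. padic_abs p (Y m - Y n) < e / A"
    using X Y unfolding padic_cauchy_def by meson
  have "padic_abs p (X m * Y m - X n * Y n) < e" if mn: "m \<ge> max k l" "n \<ge> max k l" for m n
  proof -
    have 1: "padic_abs p (X m * (Y m - Y n)) < e"
    proof -
      have "padic_abs p (X m * (Y m - Y n)) \<le> A * padic_abs p (Y m - Y n)"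
        by (simp add: padic_abs_mult[OF p] A mult_right_mono padic_abs_nonneg)
      also have "\<dots> < A * (e / A)" using l mn A by (intro mult_strict_left_mono) auto
      finally show ?thesis using A by simp
    qed
    have 2: "padic_abs p ((X m - X n) * Y n) < e"
    proof -
      have "padic_abs p ((X m - X n) * Y n) \<le> padic_abs p (X m - X n) * B"
        by (simp add: padic_abs_mult[OF p] B mult_left_mono padic_abs_nonneg)
      also have "\<dots> < (e / B) * B" using k mn B by (intro mult_strict_right_mono) auto
      finally show ?thesis using B by simp
    qed
    have "X m * Y m - X n * Y n = X m * (Y m - Y n) + (X m - X n) * Y n"
      by (simp add: algebra_simps)
    then show ?thesis using padic_abs_ultrametric[OF p, of "X m * (Y m - Y n)" "(X m - X n) * Y n"] 1 2
      by simp
  qed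
  then show "\<exists>k. \<forall>m\<ge>k. \<forall>n\<ge>k. padic_abs p (X m * Y m - X n * Y n) < e" by blast
qed

lemma padic_cauchy_not_null:
  assumes p: "prime p" and X: "padic_cauchy p X" and nz: "\<not> padic_null p X"
  obtains b k where "b > 0" "\<And>n. n \<ge> k \<Longrightarrow> padic_abs p (X n) > b"
proof -
  obtain L where L: "(\<lambda>n. padic_abs p (X n)) \<longlonglongrightarrow> L"
    using padic_cauchy_abs[OF p X] convergent_def by blast
  have "L \<ge> 0" using L by (rule LIMSEQ_le_const) (simp add: padic_abs_nonneg)
  moreover have "L \<noteq> 0" using L nz unfolding padic_null_def by blast
  ultimately have "L > 0" by simp
  then have "\<forall>\<^sub>F n in sequentially. padic_abs p (X n) > L / 2"
    by (intro order_tendstoD(1)[OF L]) simp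
  then show ?thesis using that[of "L / 2"] \<open>L > 0\<close> unfolding eventually_sequentially by auto
qed

lemma padic_abs_inverse_diff:
  assumes p: "prime p" and x: "padic_abs p x > a" and y: "padic_abs p y > b" and ab: "a > 0" "b > 0"
  shows "padic_abs p (inverse x - inverse y) \<le> padic_abs p (x - y) / (a * b)"
proof -
  have nz: "x \<noteq> 0" "y \<noteq> 0" using x y ab by auto
  have "inverse x - inverse y = (y - x) * (inverse x * inverse y)"
    using nz by (simp add: field_simps)
  moreover have "padic_abs p (y - x) = padic_abs p (x - y)"
    using padic_abs_minus[OF p, of "x - y"] by simp
  ultimately have "padic_abs p (inverse x - inverse y)
      = padic_abs p (x - y) * inverse (padic_abs p x * padic_abs p y)"
    by (simp add: padic_abs_mult[OF p] padic_abs_inverse[OF p])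
  also have "\<dots> \<le> padic_abs p (x - y) * inverse (a * b)"
    using x y ab by (intro mult_left_mono le_imp_inverse_le mult_mono) (auto simp: padic_abs_nonneg)
  finally show ?thesis by (simp add: divide_inverse)
qed

lemma padic_cauchy_inverse:
  assumes p: "prime p" and X: "padic_cauchy p X" and nz: "\<not> padic_null p X"
  shows "padic_cauchy p (\<lambda>n. inverse (X n))"
  unfolding padic_cauchy_def
proof (intro allI impI)
  fix e :: real assume e: "e > 0"
  obtain b k where b: "b > 0" "\<And>n. n \<ge> k \<Longrightarrow> padic_abs p (X n) > b"
    using padic_cauchy_not_null[OF p X nz] by blast
  have "e * (b * b) > 0" using e b by simp
  then obtain l where l: "\<forall>m\<ge>l. \<forall>n\<ge>l. padic_abs p (X m - X n) < e * (b * b)"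
    using X unfolding padic_cauchy_def by meson
  have "padic_abs p (inverse (X m) - inverse (X n)) < e" if mn: "m \<ge> max k l" "n \<ge> max k l" for m n
  proof -
    have "padic_abs p (inverse (X m) - inverse (X n)) \<le> padic_abs p (X m - X n) / (b * b)"
      using b mn by (intro padic_abs_inverse_diff[OF p]) auto
    also have "\<dots> < e" using l mn b by (simp add: pos_divide_less_eq)
    finally show ?thesis .
  qed
  then show "\<exists>k. \<forall>m\<ge>k. \<forall>n\<ge>k. padic_abs p (inverse (X m) - inverse (X n)) < e" by blast
qed

lemma padic_null_inverse_diff:
  assumes p: "prime p" and X: "padic_cauchy p X" "\<not> padic_null p X"
    and Y: "padic_cauchy p Y" "\<not> padic_null p Y" and XY: "padic_null p (\<lambda>n. X n - Y n)"
  shows "padic_null p (\<lambda>n. inverse (X n) - inverse (Y n))"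
proof -
  obtain a k where a: "a > 0" "\<And>n. n \<ge> k \<Longrightarrow> padic_abs p (X n) > a"
    using padic_cauchy_not_null[OF p X] by blast
  obtain b l where b: "b > 0" "\<And>n. n \<ge> l \<Longrightarrow> padic_abs p (Y n) > b"
    using padic_cauchy_not_null[OF p Y] by blast
  show ?thesis
  proof (rule padic_null_bound)
    show "(\<lambda>n. padic_abs p (X n - Y n) / (a * b)) \<longlonglongrightarrow> 0"
      using XY unfolding padic_null_def by (rule tendsto_divide_zero)
    show "\<forall>\<^sub>F n in sequentially. padic_abs p (inverse (X n) - inverse (Y n))
        \<le> padic_abs p (X n - Y n) / (a * b)"
      unfolding eventually_sequentially
      by (rule exI[of _ "max k l"]) (use a b padic_abs_inverse_diff[OF p] in auto)
  qed
qed

typedef (overloaded) 'a padic_seq = "{X. padic_cauchy CARD('a::prime_card) X}"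
  by (rule exI[of _ "\<lambda>_. 0"]) simp

setup_lifting type_definition_padic_seq

instantiation padic_seq :: (prime_card) comm_ring_1
begin

lift_definition zero_padic_seq :: "'a padic_seq" is "\<lambda>n. 0" by simp

lift_definition one_padic_seq :: "'a padic_seq" is "\<lambda>n. 1" by simp

lift_definition plus_padic_seq :: "'a padic_seq \<Rightarrow> 'a padic_seq \<Rightarrow> 'a padic_seq"
  is "\<lambda>X Y n. X n + Y n" by (rule padic_cauchy_add[OF prime_card])

lift_definition uminus_padic_seq :: "'a padic_seq \<Rightarrow> 'a padic_seq"
  is "\<lambda>X n. - X n" by (rule padic_cauchy_uminus[OF prime_card])

lift_definition minus_padic_seq :: "'a padic_seq \<Rightarrow> 'a padic_seq \<Rightarrow> 'a padic_seq"
  is "\<lambda>X Y n. X n - Y n"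
  using padic_cauchy_add[OF prime_card] padic_cauchy_uminus[OF prime_card] by fastforce

lift_definition times_padic_seq :: "'a padic_seq \<Rightarrow> 'a padic_seq \<Rightarrow> 'a padic_seq"
  is "\<lambda>X Y n. X n * Y n" by (rule padic_cauchy_mult[OF prime_card])

instance
proof
  show "(0::'a padic_seq) \<noteq> 1" by transfer (auto dest: fun_cong)
qed (transfer; simp add: algebra_simps)+

end

lift_definition null_seq :: "'a::prime_card padic_seq \<Rightarrow> bool" is "padic_null CARD('a)" .

lift_definition abs_seq :: "'a::prime_card padic_seq \<Rightarrow> nat \<Rightarrow> real"
  is "\<lambda>X n. padic_abs CARD('a) (X n)" .

lift_definition inverse_seq :: "'a::prime_card padic_seq \<Rightarrow> 'a padic_seq"
  is "\<lambda>X. if padic_null CARD('a) X then (\<lambda>n. 0) else (\<lambda>n. inverse (X n))"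
  by (simp add: padic_cauchy_inverse[OF prime_card])

lift_definition const_seq :: "rat \<Rightarrow> 'a::prime_card padic_seq" is "\<lambda>q n. q" by simp

lemma null_seq_add: "null_seq X \<Longrightarrow> null_seq Y \<Longrightarrow> null_seq (X + Y)"
  by transfer (rule padic_null_add[OF prime_card])

lemma null_seq_minus: "null_seq (X - Y) \<Longrightarrow> null_seq (Y - X)"
  by transfer (use padic_null_minus[OF prime_card] in fastforce)

lemma null_seq_mult: "null_seq Y \<Longrightarrow> null_seq (X * Y)"
  by transfer (rule padic_null_mult[OF prime_card])

lemma null_seq_0 [simp]: "null_seq 0"
  by transfer (simp add: padic_null_const[OF prime_card])

lemma null_seq_const [simp]: "null_seq (const_seq q :: 'a::prime_card padic_seq) \<longleftrightarrow> q = 0"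
  by transfer (simp add: padic_null_const[OF prime_card])

lemma null_seq_inverse_diff:
  "\<not> null_seq X \<Longrightarrow> \<not> null_seq Y \<Longrightarrow> null_seq (X - Y) \<Longrightarrow> null_seq (inverse_seq X - inverse_seq Y)"
  by transfer (simp add: padic_null_inverse_diff[OF prime_card])

lemma null_seq_inverse_mult: 
  assumes "\<not> null_seq X" shows "null_seq (inverse_seq X * X - 1)"
  using assms
proof (transfer, simp)
  fix X assume X: "padic_cauchy CARD('a) X" "\<not> padic_null CARD('a) X"
  show "padic_null CARD('a) (\<lambda>n. inverse (X n) * X n - 1)"
  proof (rule padic_null_bound)
    obtain b k where b: "b > 0" "\<And>n. n \<ge> k \<Longrightarrow> padic_abs CARD('a) (X n) > b"
      using padic_cauchy_not_null[OF prime_card X] by blast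
    have "inverse (X n) * X n - 1 = 0" if "n \<ge> k" for n
      using b(1) b(2)[OF that] by (cases "X n = 0") auto
    then show "\<forall>\<^sub>F n in sequentially. padic_abs CARD('a) (inverse (X n) * X n - 1) \<le> 0"
      unfolding eventually_sequentially by (metis order_refl padic_abs_0)
  qed simp
qed

lemma abs_seq_LIMSEQ: "abs_seq X \<longlonglongrightarrow> lim (abs_seq X)"
  by transfer (simp add: padic_cauchy_abs[OF prime_card] flip: convergent_LIMSEQ_iff)

lemma lim_abs_seq_eq:
  assumes "null_seq (X - Y)" shows "lim (abs_seq X) = lim (abs_seq Y)"
proof -
  have "(\<lambda>n. abs_seq X n - abs_seq Y n) \<longlonglongrightarrow> 0"
    using assms
  proof transfer
    fix X Y :: "nat \<Rightarrow> rat"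
    assume "padic_null CARD('a) (\<lambda>n. X n - Y n)"
    then show "(\<lambda>n. padic_abs CARD('a) (X n) - padic_abs CARD('a) (Y n)) \<longlonglongrightarrow> 0"
      unfolding padic_null_def
      by (rule Lim_null_comparison[rotated]) (simp add: padic_abs_diff_triangle[OF prime_card])
  qed
  from tendsto_add[OF this abs_seq_LIMSEQ[of Y]] have "abs_seq X \<longlonglongrightarrow> lim (abs_seq Y)" by simp
  then show ?thesis by (rule limI)
qed

definition seq_rel :: "'a::prime_card padic_seq \<Rightarrow> 'a padic_seq \<Rightarrow> bool" where
  "seq_rel X Y \<longleftrightarrow> null_seq (X - Y)"

quotient_type (overloaded) 'a padic = "'a::prime_card padic_seq" / seq_rel
  morphisms rep_padic Padic
proof (rule equivpI)
  show "reflp (seq_rel :: 'a padic_seq \<Rightarrow> _)" by (simp add: reflp_def seq_rel_def)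
  show "symp (seq_rel :: 'a padic_seq \<Rightarrow> _)" by (auto simp: symp_def seq_rel_def null_seq_minus)
  have "null_seq (X - Z)" if "null_seq (X - Y)" "null_seq (Y - Z)" for X Y Z :: "'a padic_seq"
    using null_seq_add[OF that] by simp
  then show "transp (seq_rel :: 'a padic_seq \<Rightarrow> _)" unfolding transp_def seq_rel_def by blast
qed

instantiation padic :: (prime_card) field
begin

lift_definition zero_padic :: "'a padic" is 0 .

lift_definition one_padic :: "'a padic" is 1 .

lift_definition plus_padic :: "'a padic \<Rightarrow> 'a padic \<Rightarrow> 'a padic" is "(+)"
  unfolding seq_rel_def add_diff_add by (rule null_seq_add)

lift_definition uminus_padic :: "'a padic \<Rightarrow> 'a padic" is uminus
  unfolding seq_rel_def minus_diff_minus by (metis minus_diff_eq null_seq_minus)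

lift_definition minus_padic :: "'a padic \<Rightarrow> 'a padic \<Rightarrow> 'a padic" is "(-)"
  unfolding seq_rel_def by (metis diff_diff_eq2 diff_add_eq add_diff_eq add.commute
      null_seq_add null_seq_minus diff_diff_add)

lift_definition times_padic :: "'a padic \<Rightarrow> 'a padic \<Rightarrow> 'a padic" is "(*)"
proof -
  fix X X' Y Y' :: "'a padic_seq"
  assume "seq_rel X X'" "seq_rel Y Y'"
  then have "null_seq (X * (Y - Y') + Y' * (X - X'))"
    by (simp add: seq_rel_def null_seq_add null_seq_mult)
  then show "seq_rel (X * Y) (X' * Y')" by (simp add: seq_rel_def algebra_simps)
qed

lift_definition inverse_padic :: "'a padic \<Rightarrow> 'a padic" is inverse_seq
proof -
  fix X Y :: "'a padic_seq"
  assume "seq_rel X Y"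
  then have n: "null_seq (X - Y)" "null_seq (Y - X)" by (auto simp: seq_rel_def null_seq_minus)
  show "seq_rel (inverse_seq X) (inverse_seq Y)"
  proof (cases "null_seq X")
    case True
    then have "null_seq Y" using null_seq_add[OF True n(2)] by simp
    with True have "inverse_seq X = inverse_seq Y" by transfer simp
    then show ?thesis by (simp add: seq_rel_def)
  next
    case False
    then have "\<not> null_seq Y" using null_seq_add[OF _ n(1), of Y] by auto
    then show ?thesis using False n by (simp add: seq_rel_def null_seq_inverse_diff)
  qed
qed

definition "x div y = x * inverse y" for x y :: "'a padic"

instance
proof
  fix a b c :: "'a padic"
  show "(0::'a padic) \<noteq> 1"
  proof transfer
    have "(0 - 1 :: 'a padic_seq) = const_seq (- 1)" by transfer simp
    then show "\<not> seq_rel (0 :: 'a padic_seq) 1" by (simp add: seq_rel_def)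
  qed
  show "a \<noteq> 0 \<Longrightarrow> inverse a * a = 1"
    by transfer (simp add: seq_rel_def null_seq_inverse_mult)
  show "inverse (0::'a padic) = 0"
  proof transfer
    have "inverse_seq (0 :: 'a padic_seq) = 0"
      by transfer (simp add: padic_null_const[OF prime_card])
    then show "seq_rel (inverse_seq (0 :: 'a padic_seq)) 0" by (simp add: seq_rel_def)
  qed
  show "a div b = a * inverse b"
    by (rule divide_padic_def)
qed (transfer; simp add: seq_rel_def algebra_simps)+

end

lemma Padic_exhaust: obtains X where "x = Padic X"
  using Quotient_abs_rep[OF Quotient_padic, of x] by metis

lemma of_nat_Padic: "(of_nat n :: 'a::prime_card padic) = Padic (const_seq (of_nat n))"
proof (induction n)
  case 0
  have "(0 :: 'a padic_seq) = const_seq 0" by transfer simp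
  then show ?case by (simp add: zero_padic.abs_eq)
next
  case (Suc n)
  have "(1 + const_seq (of_nat n) :: 'a padic_seq) = const_seq (of_nat (Suc n))" by transfer simp
  then show ?case by (simp only: of_nat_Suc[where ?'a = "'a padic"] Suc one_padic.abs_eq plus_padic.abs_eq)
qed

lemma Padic_const_eq_iff:
  "(Padic (const_seq q) :: 'a::prime_card padic) = Padic (const_seq r) \<longleftrightarrow> q = r"
proof -
  have "(const_seq q - const_seq r :: 'a padic_seq) = const_seq (q - r)" by transfer simp
  then show ?thesis by (simp add: padic.abs_eq_iff seq_rel_def)
qed

instance padic :: (prime_card) field_char_0
proof
  show "inj (of_nat :: nat \<Rightarrow> 'a padic)"
    by (rule injI) (simp add: of_nat_Padic Padic_const_eq_iff)
qed

lemma of_rat_Padic: "(of_rat q :: 'a::prime_card padic) = Padic (const_seq q)"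
proof -
  have int: "(of_int i :: 'a padic) = Padic (const_seq (of_int i))" for i
  proof (cases i rule: int_cases2)
    case (nonneg n)
    then show ?thesis by (simp add: of_nat_Padic)
  next
    case (nonpos n)
    have "(- const_seq (of_nat n) :: 'a padic_seq) = const_seq (- of_nat n)" by transfer simp
    then show ?thesis using nonpos by (simp add: of_nat_Padic uminus_padic.abs_eq)
  qed
  obtain a b where q: "q = of_int a / of_int b" "b > 0" by (rule rat_fraction)
  have 1: "(of_rat q :: 'a padic) * of_int b = of_int a"
    using q by (simp add: of_rat_divide)
  have "(const_seq q * const_seq (of_int b) :: 'a padic_seq) = const_seq (of_int a)"
    using q by transfer simp
  then have "(Padic (const_seq q) :: 'a padic) * of_int b = of_int a"
    by (simp add: int times_padic.abs_eq)
  with 1 have "(of_rat q :: 'a padic) * of_int b = Padic (const_seq q) * of_int b" by simp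
  moreover have "(of_int b :: 'a padic) \<noteq> 0" using q by simp
  ultimately show ?thesis by simp
qed

lift_definition padic_norm :: "'a::prime_card padic \<Rightarrow> real" is "\<lambda>X. lim (abs_seq X)"
  by (simp add: seq_rel_def lim_abs_seq_eq)

lemma norm_Padic: "abs_seq X \<longlonglongrightarrow> padic_norm (Padic X)"
  unfolding padic_norm.abs_eq by (rule abs_seq_LIMSEQ)

lemma padic_norm_of_rat: "padic_norm (of_rat q :: 'a::prime_card padic) = padic_abs CARD('a) q"
proof -
  have "abs_seq (const_seq q :: 'a padic_seq) = (\<lambda>_. padic_abs CARD('a) q)" by transfer simp
  then show ?thesis using norm_Padic[of "const_seq q :: 'a padic_seq"]
    by (simp add: of_rat_Padic LIMSEQ_const_iff)
qed

lemma padic_norm_nonneg: "padic_norm (x :: 'a::prime_card padic) \<ge> 0"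
proof -
  obtain X where 1: "x = Padic X" by (rule Padic_exhaust)
  have "abs_seq X n \<ge> 0" for n by transfer (rule padic_abs_nonneg)
  then show ?thesis using norm_Padic[of X] 1 by (simp add: LIMSEQ_le_const)
qed

lemma padic_norm_eq_0: "padic_norm (x :: 'a::prime_card padic) = 0 \<longleftrightarrow> x = 0"
proof -
  obtain X where 1: "x = Padic X" by (rule Padic_exhaust)
  have "null_seq X \<longleftrightarrow> abs_seq X \<longlonglongrightarrow> 0" by transfer (simp add: padic_null_def)
  then show ?thesis using norm_Padic[of X] 1
    by (auto simp: zero_padic.abs_eq padic.abs_eq_iff seq_rel_def intro: LIMSEQ_unique)
qed

lemma padic_norm_mult: "padic_norm (x * y :: 'a::prime_card padic) = padic_norm x * padic_norm y"
proof -
  obtain X where x: "x = Padic X" by (rule Padic_exhaust)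
  obtain Y where y: "y = Padic Y" by (rule Padic_exhaust)
  have "abs_seq (X * Y) = (\<lambda>n. abs_seq X n * abs_seq Y n)"
    by transfer (simp add: padic_abs_mult[OF prime_card])
  then have "abs_seq (X * Y) \<longlonglongrightarrow> padic_norm x * padic_norm y"
    using tendsto_mult[OF norm_Padic[of X] norm_Padic[of Y]] by (simp add: x y)
  then show ?thesis using norm_Padic[of "X * Y"]
    by (simp add: x y times_padic.abs_eq LIMSEQ_unique)
qed

lemma padic_norm_minus: "padic_norm (- x :: 'a::prime_card padic) = padic_norm x"
proof -
  obtain X where 1: "x = Padic X" by (rule Padic_exhaust)
  have "abs_seq (- X) = abs_seq X"
    by transfer (simp add: padic_abs_minus[OF prime_card])
  then show ?thesis using norm_Padic[of X] norm_Padic[of "- X"]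
    by (simp add: 1 uminus_padic.abs_eq LIMSEQ_unique)
qed

lemma padic_norm_ultrametric: "padic_norm (x + y :: 'a::prime_card padic) \<le> max (padic_norm x) (padic_norm y)"
proof -
  obtain X where x: "x = Padic X" by (rule Padic_exhaust)
  obtain Y where y: "y = Padic Y" by (rule Padic_exhaust)
  have "abs_seq (X + Y) n \<le> max (abs_seq X n) (abs_seq Y n)" for n
    by transfer (rule padic_abs_ultrametric[OF prime_card])
  moreover have "(\<lambda>n. max (abs_seq X n) (abs_seq Y n)) \<longlonglongrightarrow> max (padic_norm x) (padic_norm y)"
    unfolding x y by (intro tendsto_max norm_Padic)
  moreover have "abs_seq (X + Y) \<longlonglongrightarrow> padic_norm (x + y)"
    using norm_Padic[of "X + Y"] by (simp add: x y plus_padic.abs_eq)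
  ultimately show ?thesis by (meson LIMSEQ_le)
qed

instantiation padic :: (prime_card) metric_space
begin

definition "dist x y = padic_norm (x - y)" for x y :: "'a padic"

definition uniformity_padic :: "('a padic \<times> 'a padic) filter" where
  "uniformity_padic = (INF e\<in>{0<..}. principal {(x, y). dist x y < e})"

definition open_padic :: "'a padic set \<Rightarrow> bool" where
  "open_padic U \<longleftrightarrow> (\<forall>x\<in>U. \<forall>\<^sub>F (x', y) in uniformity. x' = x \<longrightarrow> y \<in> U)"

instance
proof
  fix x y z :: "'a padic"
  show "dist x y = 0 \<longleftrightarrow> x = y" by (simp add: dist_padic_def padic_norm_eq_0)
  have "padic_norm (x - y) \<le> max (padic_norm (x - z)) (padic_norm (z - y))"
    using padic_norm_ultrametric[of "x - z" "z - y"] by simp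
  moreover have "padic_norm (z - y) = padic_norm (y - z)" using padic_norm_minus[of "y - z"] by simp
  ultimately show "dist x y \<le> dist x z + dist y z"
    using padic_norm_nonneg[of "x - z"] padic_norm_nonneg[of "y - z"]
    by (simp add: dist_padic_def)
qed (simp_all add: uniformity_padic_def open_padic_def)

end

text \<open>The following two facts confirm that this metric space is the completion of \<open>\<rat>\<close>.\<close>

lemma of_rat_dense_padic:
  assumes "e > 0" shows "\<exists>q. dist (x :: 'a::prime_card padic) (of_rat q) < e"
proof -
  obtain X where 1: "x = Padic X" by (rule Padic_exhaust)
  have "\<exists>k. \<forall>n\<ge>k. abs_seq (X - const_seq (Rep_padic_seq X k)) n < e / 2"
    using assms
  proof transfer
    fix e :: real and X assume "e > 0" "padic_cauchy CARD('a) X"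
    then show "\<exists>k. \<forall>n\<ge>k. padic_abs CARD('a) (X n - X k) < e / 2"
      unfolding padic_cauchy_def by (meson half_gt_zero order_refl)
  qed
  then obtain k where k: "\<forall>n\<ge>k. abs_seq (X - const_seq (Rep_padic_seq X k)) n < e / 2" ..
  have "padic_norm (Padic (X - const_seq (Rep_padic_seq X k))) \<le> e / 2"
    using k by (intro LIMSEQ_le_const2[OF norm_Padic]) (meson less_imp_le)
  then have "dist x (of_rat (Rep_padic_seq X k)) < e"
    using assms by (simp add: dist_padic_def 1 of_rat_Padic minus_padic.abs_eq)
  then show ?thesis ..
qed

instance padic :: (prime_card) complete_space
proof
  fix x :: "nat \<Rightarrow> 'a padic" assume x: "Cauchy x"
  have "\<forall>n. \<exists>q. dist (x n) (of_rat q) < 1 / real (Suc n)"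
    by (intro allI of_rat_dense_padic) simp
  then obtain Q where Q: "\<And>n. dist (x n) (of_rat (Q n)) < 1 / real (Suc n)" by metis
  have xQ: "(\<lambda>n. dist (x n) (of_rat (Q n))) \<longlonglongrightarrow> 0"
    by (rule Lim_null_comparison[OF _ LIMSEQ_Suc[OF lim_1_over_n]])
      (use Q in \<open>auto intro!: always_eventually less_imp_le\<close>)
  have cauchy: "padic_cauchy CARD('a) Q"
    unfolding padic_cauchy_def
  proof (intro allI impI)
    fix e :: real assume e: "e > 0"
    obtain k where k: "\<forall>m\<ge>k. \<forall>n\<ge>k. dist (x m) (x n) < e / 3"
      using x e unfolding Cauchy_def by (meson divide_pos_pos zero_less_numeral)
    obtain l where l: "\<forall>n\<ge>l. dist (x n) (of_rat (Q n)) < e / 3"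
      using order_tendstoD(2)[OF xQ, of "e / 3"] e unfolding eventually_sequentially by auto
    have "padic_abs CARD('a) (Q m - Q n) < e" if mn: "m \<ge> max k l" "n \<ge> max k l" for m n
    proof -
      have "padic_abs CARD('a) (Q m - Q n) = dist (of_rat (Q m) :: 'a padic) (of_rat (Q n))"
        by (simp add: dist_padic_def padic_norm_of_rat flip: of_rat_diff)
      also have "\<dots> \<le> dist (x m) (of_rat (Q m)) + dist (x m) (x n) + dist (x n) (of_rat (Q n))"
        by metric
      also have "\<dots> < e / 3 + e / 3 + e / 3"
        using k l mn by (intro add_strict_mono) auto
      finally show ?thesis by simp
    qed
    then show "\<exists>k. \<forall>m\<ge>k. \<forall>n\<ge>k. padic_abs CARD('a) (Q m - Q n) < e" by blast
  qed
  define X :: "'a padic_seq" where "X = Abs_padic_seq Q"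
  have Rep: "Rep_padic_seq X = Q" using cauchy by (simp add: X_def Abs_padic_seq_inverse)
  have QX: "(\<lambda>n. of_rat (Q n)) \<longlonglongrightarrow> Padic X"
  proof (rule metric_LIMSEQ_I)
    fix e :: real assume e: "e > 0"
    then obtain k where k: "\<forall>m\<ge>k. \<forall>n\<ge>k. padic_abs CARD('a) (Q m - Q n) < e / 2"
      using cauchy unfolding padic_cauchy_def by (meson half_gt_zero)
    have "dist (of_rat (Q n)) (Padic X) < e" if n: "n \<ge> k" for n
    proof -
      have "abs_seq (const_seq (Q n) - X) m \<le> e / 2" if "m \<ge> k" for m
        using k n that Rep by (simp add: abs_seq.rep_eq minus_padic_seq.rep_eq const_seq.rep_eq less_imp_le)
      then have "padic_norm (Padic (const_seq (Q n) - X)) \<le> e / 2"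
        by (intro LIMSEQ_le_const2[OF norm_Padic]) blast
      then show ?thesis using e by (simp add: dist_padic_def of_rat_Padic minus_padic.abs_eq)
    qed
    then show "\<exists>k. \<forall>n\<ge>k. dist (of_rat (Q n)) (Padic X) < e" by blast
  qed
  have "(\<lambda>n. dist (x n) (Padic X)) \<longlonglongrightarrow> 0"
  proof (rule tendsto_sandwich[of "\<lambda>_. 0"])
    show "(\<lambda>n. dist (x n) (of_rat (Q n)) + dist (of_rat (Q n)) (Padic X)) \<longlonglongrightarrow> 0"
      using tendsto_add_zero[OF xQ] QX[THEN tendsto_dist_iff[THEN iffD1]] by blast
  qed (auto simp: dist_triangle)
  then show "convergent x" using tendsto_dist_iff convergent_def by blast
qed


section \<open>Balls, digits, and the additive character\<close>

definition padic_ball :: "int \<Rightarrow> 'p::prime_card padic \<Rightarrow> 'p padic set" where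
  "padic_ball \<gamma> c = {x. padic_norm (x - c) \<le> real CARD('p) powi \<gamma>}"

definition padic_integers :: "'p::prime_card padic set" where
  "padic_integers = {x. padic_norm x \<le> 1}"

text \<open>\<open>x = (\<Sum>j\<ge>\<gamma>. d j * p ^ j)\<close> with digits \<open>d j \<in> {0, \<dots>, p - 1}\<close>; digits below \<open>\<gamma>\<close> play no role.\<close>

definition digit_expansion :: "'p::prime_card padic \<Rightarrow> int \<Rightarrow> (int \<Rightarrow> nat) \<Rightarrow> bool" where
  "digit_expansion x \<gamma> d \<longleftrightarrow> (\<forall>j\<ge>\<gamma>. d j < CARD('p)) \<and>
     (\<lambda>n. \<Sum>j\<in>{\<gamma>..<\<gamma> + int n}. of_nat (d j) * of_nat CARD('p) powi j) \<longlonglongrightarrow> x"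

text \<open>
  The expansion of \<open>x\<close> is unique up to leading zeros, so the sum over the negative exponents
  does not depend on it. If \<open>\<gamma> \<ge> 0\<close> the sum is empty.
\<close>

definition padic_frac :: "'p::prime_card padic \<Rightarrow> rat" where
  "padic_frac x = (THE r. \<exists>\<gamma> d. digit_expansion x \<gamma> d \<and>
     r = (\<Sum>j\<in>{\<gamma>..-1}. of_nat (d j) * of_nat CARD('p) powi j))"

definition I_p :: "'p::prime_card padic set" where
  "I_p = {x. of_rat (padic_frac x) = x}"

definition padic_char :: "'p::prime_card padic \<Rightarrow> complex" where
  "padic_char x = exp (2 * of_real pi * \<i> * of_rat (padic_frac x))"


section \<open>Haar measure, square-integrable functions, Fourier transform\<close>

definition normalized_haar :: "'p::prime_card padic measure \<Rightarrow> bool" where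
  "normalized_haar \<mu> \<longleftrightarrow> sets \<mu> = sets borel \<and>
     (\<forall>a. \<forall>A\<in>sets \<mu>. emeasure \<mu> ((\<lambda>x. a + x) ` A) = emeasure \<mu> A) \<and>
     emeasure \<mu> padic_integers = 1"

text \<open>
  Elements of \<open>L\<^sup>2\<close> are represented by functions; equality in \<open>L\<^sup>2\<close> is equality almost everywhere.
\<close>

definition L2 :: "'p::prime_card padic measure \<Rightarrow> ('p padic \<Rightarrow> complex) set" where
  "L2 \<mu> = {f. f \<in> borel_measurable \<mu> \<and> integrable \<mu> (\<lambda>x. (cmod (f x))\<^sup>2)}"

definition L2_norm :: "'p::prime_card padic measure \<Rightarrow> ('p padic \<Rightarrow> complex) \<Rightarrow> real" where
  "L2_norm \<mu> f = sqrt (\<integral>x. (cmod (f x))\<^sup>2 \<partial>\<mu>)"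

definition L2_inner ::
    "'p::prime_card padic measure \<Rightarrow> ('p padic \<Rightarrow> complex) \<Rightarrow> ('p padic \<Rightarrow> complex) \<Rightarrow> complex" where
  "L2_inner \<mu> f g = (\<integral>x. f x * cnj (g x) \<partial>\<mu>)"

definition fourier ::
    "'p::prime_card padic measure \<Rightarrow> ('p padic \<Rightarrow> complex) \<Rightarrow> 'p padic \<Rightarrow> complex" where
  "fourier \<mu> f \<xi> = (\<integral>x. padic_char (\<xi> * x) * f x \<partial>\<mu>)"

definition inverse_fourier ::
    "'p::prime_card padic measure \<Rightarrow> ('p padic \<Rightarrow> complex) \<Rightarrow> 'p padic \<Rightarrow> complex" where
  "inverse_fourier \<mu> f \<xi> = (\<integral>x. padic_char (- (\<xi> * x)) * f x \<partial>\<mu>)"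

text \<open>
  \<open>g\<close> is (a representative of) the image of \<open>f\<close> under the continuous extension of the inverse
  Fourier transform from \<open>L\<^sup>1 \<inter> L\<^sup>2\<close> to \<open>L\<^sup>2\<close>.
\<close>

definition L2_inverse_fourier ::
    "'p::prime_card padic measure \<Rightarrow> ('p padic \<Rightarrow> complex) \<Rightarrow> ('p padic \<Rightarrow> complex) \<Rightarrow> bool" where
  "L2_inverse_fourier \<mu> f g \<longleftrightarrow> f \<in> L2 \<mu> \<and> g \<in> L2 \<mu> \<and>
     (\<exists>F. (\<forall>n. integrable \<mu> (F n) \<and> F n \<in> L2 \<mu> \<and> inverse_fourier \<mu> (F n) \<in> L2 \<mu>) \<and>
        (\<lambda>n. L2_norm \<mu> (\<lambda>x. F n x - f x)) \<longlonglongrightarrow> 0 \<and>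
        (\<lambda>n. L2_norm \<mu> (\<lambda>x. inverse_fourier \<mu> (F n) x - g x)) \<longlonglongrightarrow> 0)"

text \<open>
  Unconditional convergence \<open>f = (\<Sum>a\<in>I. c a * e a)\<close> in the norm of \<open>L\<^sup>2\<close>.
\<close>

definition L2_expansion ::
    "'p::prime_card padic measure \<Rightarrow> 'i set \<Rightarrow> ('i \<Rightarrow> 'p padic \<Rightarrow> complex) \<Rightarrow> ('i \<Rightarrow> complex)
      \<Rightarrow> ('p padic \<Rightarrow> complex) \<Rightarrow> bool" where
  "L2_expansion \<mu> I e c f \<longleftrightarrow>
     ((\<lambda>F. L2_norm \<mu> (\<lambda>x. f x - (\<Sum>a\<in>F. c a * e a x))) \<longlongrightarrow> 0) (finite_subsets_at_top I)"


section \<open>Multiresolution analyses and scaling sets\<close>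

text \<open>Closedness under \<open>L\<^sup>2\<close>-limits includes closedness under almost everywhere equality.\<close>

definition closed_L2_subspace :: "'p::prime_card padic measure \<Rightarrow> ('p padic \<Rightarrow> complex) set \<Rightarrow> bool" where
  "closed_L2_subspace \<mu> W \<longleftrightarrow> W \<subseteq> L2 \<mu> \<and> (\<lambda>_. 0) \<in> W \<and>
     (\<forall>f\<in>W. \<forall>g\<in>W. (\<lambda>x. f x + g x) \<in> W) \<and>
     (\<forall>c. \<forall>f\<in>W. (\<lambda>x. c * f x) \<in> W) \<and>
     (\<forall>F f. (\<forall>n. F n \<in> W) \<longrightarrow> f \<in> L2 \<mu> \<longrightarrow>
        (\<lambda>n. L2_norm \<mu> (\<lambda>x. F n x - f x)) \<longlonglongrightarrow> 0 \<longrightarrow> f \<in> W)"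

definition orthonormal_basis ::
    "'p::prime_card padic measure \<Rightarrow> 'i set \<Rightarrow> ('i \<Rightarrow> 'p padic \<Rightarrow> complex)
      \<Rightarrow> ('p padic \<Rightarrow> complex) set \<Rightarrow> bool" where
  "orthonormal_basis \<mu> I e W \<longleftrightarrow>
     (\<forall>a\<in>I. e a \<in> W) \<and>
     (\<forall>a\<in>I. \<forall>b\<in>I. L2_inner \<mu> (e a) (e b) = (if a = b then 1 else 0)) \<and>
     (\<forall>f\<in>W. \<forall>\<epsilon>>0. \<exists>F c. finite F \<and> F \<subseteq> I \<and> L2_norm \<mu> (\<lambda>x. f x - (\<Sum>a\<in>F. c a * e a x)) < \<epsilon>)"

definition scaling_function ::
    "'p::prime_card padic measure \<Rightarrow> (int \<Rightarrow> ('p padic \<Rightarrow> complex) set) \<Rightarrow> ('p padic \<Rightarrow> complex) \<Rightarrow> bool" where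
  "scaling_function \<mu> V \<phi> \<longleftrightarrow> \<phi> \<in> V 0 \<and> orthonormal_basis \<mu> I_p (\<lambda>a x. \<phi> (x - a)) (V 0)"

definition MRA ::
    "'p::prime_card padic measure \<Rightarrow> (int \<Rightarrow> ('p padic \<Rightarrow> complex) set) \<Rightarrow> bool" where
  "MRA \<mu> V \<longleftrightarrow>
     (\<forall>j. closed_L2_subspace \<mu> (V j)) \<and>
     (\<forall>j. V j \<subseteq> V (j + 1)) \<and>
     (\<forall>f\<in>L2 \<mu>. \<forall>\<epsilon>>0. \<exists>g\<in>(\<Union>j. V j). L2_norm \<mu> (\<lambda>x. f x - g x) < \<epsilon>) \<and>
     (\<Inter>j. V j) = {f \<in> L2 \<mu>. AE x in \<mu>. f x = 0} \<and>
     (\<forall>j f. f \<in> V j \<longleftrightarrow> (\<lambda>x. f (x / of_nat CARD('p))) \<in> V (j + 1)) \<and>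
     (\<exists>\<phi>. scaling_function \<mu> V \<phi>)"

text \<open>\<open>S\<close> is a scaling set with corresponding scaling function \<open>\<phi>\<close>.\<close>

definition scaling_set ::
    "'p::prime_card padic measure \<Rightarrow> 'p padic set \<Rightarrow> ('p padic \<Rightarrow> complex) \<Rightarrow> bool" where
  "scaling_set \<mu> S \<phi> \<longleftrightarrow> S \<in> sets \<mu> \<and> L2_inverse_fourier \<mu> (indicator S) \<phi> \<and>
     (\<exists>V. MRA \<mu> V \<and> scaling_function \<mu> V \<phi>)"

text \<open>The space \<open>D\<^sub>N\<^sup>M\<close> of test functions.\<close>

definition test_functions :: "int \<Rightarrow> int \<Rightarrow> ('p::prime_card padic \<Rightarrow> complex) set" where
  "test_functions M N = {f.
     (\<forall>x. \<exists>U. open U \<and> x \<in> U \<and> (\<forall>y\<in>U. f y = f x)) \<and>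
     (\<forall>x. f (x + of_nat CARD('p) powi M) = f x) \<and>
     (\<forall>x. x \<notin> padic_ball N 0 \<longrightarrow> f x = 0)}"

end

theory Submission
  imports Defs
begin

text \<open>
  The theorem holds because orthonormality of the translates leaves very little freedom for \<open>S\<close>:
  \<^emph>\<open>any two points of \<open>S\<close> differ by an element of \<open>\<int>\<^sub>p\<close>\<close> (\<open>spectrum_diff_integral\<close>).

  To see this, let \<open>\<xi>\<^sub>0 \<in> S\<close> and \<open>L \<ge> N\<close>, and compare the truncated character
  \<open>x \<mapsto> \<chi>\<^sub>p(-\<xi>\<^sub>0 x)\<close> on \<open>B\<^sub>L(0)\<close> with the \<open>p ^ L\<close> translates of \<open>\<phi>\<close> by elements of \<open>I\<^sub>p\<close> lying in \<open>B\<^sub>L(0)\<close>.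
  All these translates are supported in \<open>B\<^sub>L(0)\<close>, so the inner product with the translate by \<open>a\<close> is the
  conjugate of \<open>\<chi>\<^sub>p(\<xi>\<^sub>0 a)\<close> times the value of the Fourier transform of \<open>\<phi>\<close> at \<open>\<xi>\<^sub>0\<close>, which is one. The squared
  moduli of the inner products add up to \<open>p ^ L\<close>, the squared norm of the truncated character. This is the case of equality in
  Bessel's inequality, and so
  \<open>\<chi>\<^sub>p(-\<xi>\<^sub>0 x) = (\<Sum>a. \<chi>\<^sub>p(-\<xi>\<^sub>0 a) \<phi>(x - a))\<close> for almost all \<open>x\<close> in \<open>B\<^sub>L(0)\<close>
  (\<open>truncated_character_expansion\<close>). The Fourier transform of this identity at a second point \<open>\<xi>\<close> of \<open>S\<close>,
  for large \<open>L\<close>, says that the geometric sum of \<open>\<chi>\<^sub>p((\<xi> - \<xi>\<^sub>0) a)\<close> over \<open>a = j / p ^ L\<close>, \<open>0 \<le> j < p ^ L\<close>,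
  vanishes, which forces \<open>\<chi>\<^sub>p(\<xi> - \<xi>\<^sub>0) = 1\<close>.

  Since \<open>S\<close> lies in one coset \<open>\<xi>\<^sub>0 + \<int>\<^sub>p\<close>, Fourier inversion on a finite quotient group
  (\<open>fourier_inversion\<close>) gives \<open>\<phi>(x + z) = \<chi>\<^sub>p(-\<xi>\<^sub>0 z) \<phi>(x)\<close> for \<open>z \<in> \<int>\<^sub>p\<close> (\<open>phi_translate_by_integer\<close>). Therefore
  the expansion of \<open>\<phi>(x - b)\<close> has the single term \<open>\<chi>\<^sub>p(-\<xi>\<^sub>0 (a - b)) \<phi>(x - a)\<close>, where \<open>a\<close> is the fractional part of
  \<open>b\<close>. Coefficients in an orthonormal system are unique (\<open>L2_expansion_coefficient\<close>), so
  the sum in question has the single term \<open>\<chi>\<^sub>p((a - b) (\<xi> - \<xi>\<^sub>0))\<close>. This is one, because both factors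
  of its argument are in \<open>\<int>\<^sub>p\<close>.
\<close>

section \<open>The norm on the \<open>p\<close>-adic numbers\<close>

abbreviation p_pow :: "int \<Rightarrow> 'p::prime_card padic" where
  "p_pow k \<equiv> of_nat CARD('p) powi k"

lemma CARD_prime_gt_1: "1 < CARD('p::prime_card)"
  using prime_card prime_gt_1_nat by blast

lemma real_CARD_prime [simp]: "1 < real CARD('p::prime_card)" "real CARD('p::prime_card) \<noteq> 0"
  "0 < real CARD('p::prime_card)"
  using CARD_prime_gt_1[where 'p='p] by auto

lemma CARD_powi_le_iff:
  "real CARD('p::prime_card) powi j \<le> real CARD('p) powi k \<longleftrightarrow> j \<le> k"
  using power_int_increasing[of j k "real CARD('p)"] power_int_strict_increasing[of k j "real CARD('p)"]
    real_CARD_prime(1)[where 'p='p] by (metis less_imp_le not_le)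

lemma p_pow_add: "(p_pow (j + k) :: 'p::prime_card padic) = p_pow j * p_pow k"
  using CARD_prime_gt_1[where 'p='p] by (intro power_int_add) auto

lemma p_pow_mult_inverse: "(p_pow k :: 'p::prime_card padic) * p_pow (- k) = 1"
  by (subst p_pow_add[symmetric]) simp

lemma padic_norm_0 [simp]: "padic_norm (0 :: 'p::prime_card padic) = 0"
  by (simp add: padic_norm_eq_0)

lemma padic_norm_1 [simp]: "padic_norm (1 :: 'p::prime_card padic) = 1"
  using padic_norm_of_rat[of 1, where 'a='p] by simp

lemma padic_norm_inverse: "padic_norm (inverse x :: 'p::prime_card padic) = inverse (padic_norm x)"
proof (cases "x = 0")
  case False
  then have "padic_norm (inverse x) * padic_norm x = 1"
    by (simp flip: padic_norm_mult)
  then show ?thesis by (metis inverse_unique mult.commute)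
qed auto

lemma padic_norm_power: "padic_norm (x ^ n :: 'p::prime_card padic) = padic_norm x ^ n"
  by (induction n) (simp_all add: padic_norm_mult)

lemma padic_norm_of_int:
  assumes "k \<noteq> 0"
  shows "padic_norm (of_int k :: 'p::prime_card padic) = real CARD('p) powi (- int (multiplicity (int CARD('p)) k))"
  using padic_norm_of_rat[of "of_int k", where 'a='p]
    padic_abs_fraction[of "CARD('p)" k 1] assms prime_card[where 'a='p] by simp

lemma padic_norm_of_int_le_iff:
  "padic_norm (of_int k :: 'p::prime_card padic) \<le> real CARD('p) powi (- int n) \<longleftrightarrow> int CARD('p) ^ n dvd k"
proof (cases "k = 0")
  case False
  have "\<not> is_unit (int CARD('p))" using CARD_prime_gt_1[where 'p='p] by auto
  then have "int CARD('p) ^ n dvd k \<longleftrightarrow> n \<le> multiplicity (int CARD('p)) k"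
    using False power_dvd_iff_le_multiplicity by blast
  then show ?thesis
    by (simp add: padic_norm_of_int[OF False] CARD_powi_le_iff)
qed simp

lemma padic_norm_of_int_le_1: "padic_norm (of_int k :: 'p::prime_card padic) \<le> 1"
  using padic_norm_of_int_le_iff[of k 0, where 'p='p] by simp

lemma padic_norm_of_nat_le_1: "padic_norm (of_nat k :: 'p::prime_card padic) \<le> 1"
  using padic_norm_of_int_le_1[of "int k", where 'p='p] by simp

lemma padic_norm_p_pow [simp]:
  "padic_norm (p_pow k :: 'p::prime_card padic) = real CARD('p) powi (- k)"
proof -
  have "multiplicity (int CARD('p)) (int CARD('p)) = 1"
    using CARD_prime_gt_1[where 'p='p] by (intro multiplicity_self) auto
  then have "padic_norm (of_nat CARD('p) :: 'p padic) = inverse (real CARD('p))"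
    using padic_norm_of_int[of "int CARD('p)", where 'p='p] CARD_prime_gt_1[where 'p='p]
    by (simp add: power_int_minus)
  then show ?thesis
    by (simp add: power_int_def padic_norm_power padic_norm_inverse)
qed

lemma padic_norm_diff_commute: "padic_norm (x - y :: 'p::prime_card padic) = padic_norm (y - x)"
  using padic_norm_minus[of "x - y"] by simp

lemma padic_norm_add_le:
  "padic_norm (x :: 'p::prime_card padic) \<le> r \<Longrightarrow> padic_norm y \<le> r \<Longrightarrow> padic_norm (x + y) \<le> r"
  using padic_norm_ultrametric[of x y] by linarith

lemma padic_norm_diff_le:
  "padic_norm (x :: 'p::prime_card padic) \<le> r \<Longrightarrow> padic_norm y \<le> r \<Longrightarrow> padic_norm (x - y) \<le> r"
  using padic_norm_add_le[of x r "- y"] by (simp add: padic_norm_minus)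

lemma padic_norm_sum_le:
  "0 \<le> r \<Longrightarrow> (\<And>i. i \<in> I \<Longrightarrow> padic_norm (f i :: 'p::prime_card padic) \<le> r) \<Longrightarrow> padic_norm (sum f I) \<le> r"
  by (induction I rule: infinite_finite_induct) (auto intro: padic_norm_add_le)

lemma padic_norm_mult_p_pow_le_iff:
  "padic_norm (x * p_pow k :: 'p::prime_card padic) \<le> real CARD('p) powi l
     \<longleftrightarrow> padic_norm x \<le> real CARD('p) powi (k + l)"
  by (simp add: padic_norm_mult power_int_minus power_int_add field_simps)

text \<open>A rational number within distance less than one of a \<open>p\<close>-adic integer has a denominator prime
  to \<open>p\<close>, which can therefore be inverted modulo \<open>p ^ n\<close>.\<close>

lemma padic_integer_approx:
  assumes "padic_norm (x :: 'p::prime_card padic) \<le> 1"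
  obtains j where "j < CARD('p) ^ n" "padic_norm (x - of_nat j) \<le> real CARD('p) powi (- int n)"
proof -
  let ?p = "int CARD('p)" and ?e = "real CARD('p) powi (- int n)"
  have e: "0 < ?e" "?e \<le> 1" by (auto simp: power_int_minus intro!: inverse_le_1_iff[THEN iffD2])
  obtain q where q: "padic_norm (x - of_rat q) < ?e"
    using of_rat_dense_padic[OF e(1), of x] by (auto simp: dist_padic_def)
  then have q1: "padic_norm (of_rat q :: 'p padic) \<le> 1"
    using padic_norm_diff_le[of x 1 "x - of_rat q"] assms e by simp
  obtain u v where uv: "quotient_of q = (u, v)" by fastforce
  have v: "v > 0" "coprime u v" "q = of_int u / of_int v"
    using quotient_of_denom_pos[OF uv] quotient_of_coprime[OF uv] quotient_of_div[OF uv] by auto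
  have qv: "(of_rat q :: 'p padic) = of_int u / of_int v"
    by (simp add: v of_rat_divide)
  have prime: "prime ?p" by (rule prime_card_int)
  have pv: "\<not> ?p dvd v"
  proof
    assume "?p dvd v"
    then have "\<not> ?p dvd u" using v(2) prime by (meson coprime_common_divisor not_prime_unit)
    have "padic_norm (of_int u :: 'p padic) \<le> padic_norm (of_int v :: 'p padic)"
    proof -
      have "(of_int u :: 'p padic) = of_rat q * of_int v" using v(1) by (simp add: qv)
      then show ?thesis
        using mult_right_mono[OF q1 padic_norm_nonneg[of "of_int v :: 'p padic"]]
        by (simp add: padic_norm_mult)
    qed
    also have "\<dots> \<le> real CARD('p) powi (- int 1)"
      using \<open>?p dvd v\<close> by (subst padic_norm_of_int_le_iff) simp
    finally show False using \<open>\<not> ?p dvd u\<close> by (subst (asm) padic_norm_of_int_le_iff) simp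
  qed
  then have "multiplicity ?p v = 0" by (simp add: not_dvd_imp_multiplicity_0)
  then have nv: "padic_norm (of_int v :: 'p padic) = 1" using v by (simp add: padic_norm_of_int)
  have "coprime v (?p ^ n)"
    using pv prime by (metis coprime_commute coprime_power_left_iff prime_imp_coprime)
  then obtain w where w: "[v * w = 1] (mod ?p ^ n)" using cong_solve_coprime_int by blast
  define j where "j = nat ((u * w) mod ?p ^ n)"
  have jint: "int j = (u * w) mod ?p ^ n" using prime by (simp add: j_def prime_gt_0_int)
  then have jlt: "j < CARD('p) ^ n"
    using prime by (metis of_nat_less_iff of_nat_power pos_mod_bound prime_gt_0_int zero_less_power)
  have "[v * int j = v * (u * w)] (mod ?p ^ n)" by (simp add: jint cong_def mod_mult_right_eq)
  also have "v * (u * w) = u * (v * w)" by simp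
  also have "[\<dots> = u * 1] (mod ?p ^ n)" using w by (rule cong_scalar_left)
  finally have "?p ^ n dvd u - v * int j"
    by (metis cong_iff_dvd_diff cong_sym mult_1_right)
  then have "padic_norm (of_int (u - v * int j) :: 'p padic) \<le> ?e"
    by (subst padic_norm_of_int_le_iff)
  moreover have "(of_rat q - of_nat j :: 'p padic) = of_int (u - v * int j) * inverse (of_int v)"
    using v by (simp add: qv field_simps)
  ultimately have "padic_norm (of_rat q - of_nat j :: 'p padic) \<le> ?e"
    by (simp add: padic_norm_mult padic_norm_inverse nv)
  then have "padic_norm (x - of_nat j) \<le> ?e"
    using padic_norm_add_le[of "x - of_rat q" ?e "of_rat q - of_nat j"] q by simp
  with jlt show ?thesis by (rule that)
qed


section \<open>Digits, fractional parts and the additive character\<close>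

text \<open>The greedy algorithm: read off the residue modulo \<open>p\<close>, subtract it, divide by \<open>p\<close>, repeat.\<close>

lemma padic_integer_digits:
  assumes "padic_norm (y :: 'p::prime_card padic) \<le> 1"
  obtains d :: "nat \<Rightarrow> nat" where "\<And>i. d i < CARD('p)"
    "\<And>n. padic_norm (y - (\<Sum>i<n. of_nat (d i) * p_pow (int i))) \<le> real CARD('p) powi (- int n)"
proof -
  have "\<forall>x::'p padic. \<exists>j. padic_norm x \<le> 1 \<longrightarrow>
      j < CARD('p) \<and> padic_norm (x - of_nat j) \<le> real CARD('p) powi (- 1)"
    using padic_integer_approx[of _ 1, where 'p='p] by (metis of_nat_1 power_one_right)
  then obtain dig where dig: "\<And>x::'p padic. padic_norm x \<le> 1 \<Longrightarrow>
      dig x < CARD('p) \<and> padic_norm (x - of_nat (dig x)) \<le> real CARD('p) powi (- 1)"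
    by metis
  define Y where "Y n = ((\<lambda>z. (z - of_nat (dig z)) * p_pow (- 1)) ^^ n) y" for n
  have Y: "Y 0 = y" "Y (Suc n) = (Y n - of_nat (dig (Y n))) * p_pow (- 1)" for n
    by (simp_all add: Y_def)
  have Y1: "padic_norm (Y n) \<le> 1" for n
  proof (induction n)
    case (Suc n)
    show ?case
      using dig[OF Suc] padic_norm_mult_p_pow_le_iff[of "Y n - of_nat (dig (Y n))" "- 1" 0]
      by (simp add: Y(2))
  qed (simp add: Y assms)
  have exp: "y = (\<Sum>i<n. of_nat (dig (Y i)) * p_pow (int i)) + Y n * p_pow (int n)" for n
  proof (induction n)
    case (Suc n)
    have "Y n = of_nat (dig (Y n)) + Y (Suc n) * p_pow 1"
      unfolding Y(2) mult.assoc p_pow_add[symmetric] by simp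
    then have "Y n * p_pow (int n) = (of_nat (dig (Y n)) + Y (Suc n) * p_pow 1) * p_pow (int n)"
      by (rule arg_cong)
    also have "\<dots> = of_nat (dig (Y n)) * p_pow (int n) + Y (Suc n) * p_pow (1 + int n)"
      by (simp only: p_pow_add distrib_right mult.assoc)
    finally have "Y n * p_pow (int n) = \<dots>" .
    then show ?case using Suc by (simp add: add.commute)
  qed (simp add: Y)
  have "y - (\<Sum>i<n. of_nat (dig (Y i)) * p_pow (int i)) = Y n * p_pow (int n)" for n
    using exp[of n] by (simp add: algebra_simps)
  then have "padic_norm (y - (\<Sum>i<n. of_nat (dig (Y i)) * p_pow (int i))) \<le> real CARD('p) powi (- int n)" for n
    using padic_norm_mult_p_pow_le_iff[of "Y n" "int n" "- int n"] Y1[of n] by simp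
  with dig Y1 show ?thesis by (intro that[of "\<lambda>i. dig (Y i)"]) auto
qed

lemma padic_norm_le_p_power:
  obtains L :: nat where "padic_norm (x :: 'p::prime_card padic) \<le> real CARD('p) ^ L" "L \<ge> L\<^sub>0"
proof -
  obtain n where n: "padic_norm x < real CARD('p) ^ n"
    using real_arch_pow[OF real_CARD_prime(1)] by blast
  also have "\<dots> \<le> real CARD('p) ^ max n L\<^sub>0"
    using real_CARD_prime(1)[where 'p='p] by (intro power_increasing) auto
  finally show ?thesis using that[of "max n L\<^sub>0"] by simp
qed

lemma CARD_powi_tendsto_0: "(\<lambda>n. real CARD('p::prime_card) powi (l - int n)) \<longlonglongrightarrow> 0"
proof -
  have "(\<lambda>n. real CARD('p) powi l * inverse (real CARD('p)) ^ n) \<longlonglongrightarrow> 0"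
    using real_CARD_prime(1)[where 'p='p]
    by (intro tendsto_mult_right_zero LIMSEQ_realpow_zero) (auto simp: inverse_less_1_iff)
  then show ?thesis by (simp add: power_int_diff divide_inverse power_inverse)
qed

lemma digit_expansion_exists: "\<exists>\<gamma> d. digit_expansion (x :: 'p::prime_card padic) \<gamma> d"
proof -
  obtain L where L: "padic_norm x \<le> real CARD('p) ^ L"
    by (rule padic_norm_le_p_power)
  then have x1: "padic_norm (x * p_pow (int L)) \<le> 1"
    using padic_norm_mult_p_pow_le_iff[of x "int L" 0] by simp
  obtain d where d: "\<And>i. d i < CARD('p)"
    "\<And>n. padic_norm (x * p_pow (int L) - (\<Sum>i<n. of_nat (d i) * p_pow (int i))) \<le> real CARD('p) powi (- int n)"
    by (rule padic_integer_digits[OF x1]) (rule that)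
  define d' where "d' j = d (nat (j + int L))" for j
  have sum: "(\<Sum>j\<in>{- int L..<- int L + int n}. of_nat (d' j) * p_pow j)
      = (\<Sum>i<n. of_nat (d i) * p_pow (int i)) * (p_pow (- int L) :: 'p padic)" for n
  proof -
    have "(\<Sum>j\<in>{- int L..<- int L + int n}. of_nat (d' j) * (p_pow j :: 'p padic))
        = (\<Sum>i<n. of_nat (d i) * p_pow (int i + - int L))"
      by (rule sum.reindex_bij_witness[of _ "\<lambda>i. int i + - int L" "\<lambda>j. nat (j + int L)"])
        (simp_all add: d'_def nat_less_iff)
    also have "\<dots> = (\<Sum>i<n. of_nat (d i) * p_pow (int i) * (p_pow (- int L) :: 'p padic))"
      by (intro sum.cong refl) (simp only: p_pow_add mult.assoc)
    finally show ?thesis by (simp only: sum_distrib_right)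
  qed
  have "x = x * p_pow (int L) * p_pow (- int L)"
    by (simp only: mult.assoc p_pow_mult_inverse mult_1_right)
  then have "x - (\<Sum>i<n. of_nat (d i) * p_pow (int i)) * p_pow (- int L)
      = (x * p_pow (int L) - (\<Sum>i<n. of_nat (d i) * p_pow (int i))) * p_pow (- int L)" for n
    by (simp add: left_diff_distrib)
  then have "padic_norm (x - (\<Sum>i<n. of_nat (d i) * p_pow (int i)) * p_pow (- int L))
      \<le> real CARD('p) powi (int L - int n)" for n
    using d(2)[of n] by (simp only: padic_norm_mult_p_pow_le_iff) simp
  then have "dist ((\<Sum>i<n. of_nat (d i) * p_pow (int i)) * p_pow (- int L)) x
      \<le> real CARD('p) powi (int L - int n)" for n
    by (simp only: dist_padic_def padic_norm_diff_commute)
  then have "(\<lambda>n. (\<Sum>i<n. of_nat (d i) * p_pow (int i)) * p_pow (- int L)) \<longlonglongrightarrow> x"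
    by (intro metric_tendsto_imp_tendsto[OF CARD_powi_tendsto_0[of "int L", where 'p='p]] always_eventually)
      simp
  then have "digit_expansion x (- int L) d'"
    unfolding digit_expansion_def sum using d(1) by (auto simp: d'_def)
  then show ?thesis by blast
qed

text \<open>The ring \<open>\<int>[1/p]\<close>, in which fractional parts live.\<close>

definition p_localized_ints :: "nat \<Rightarrow> rat set" where
  "p_localized_ints p = {of_int k / of_nat p ^ n | k n. True}"

lemma p_localized_intsI: "r = of_int k / of_nat p ^ n \<Longrightarrow> r \<in> p_localized_ints p"
  by (auto simp: p_localized_ints_def)

lemma p_localized_ints_of_int: "of_int k \<in> p_localized_ints p"
  by (rule p_localized_intsI[of _ k _ 0]) simp

lemma p_localized_ints_add:
  assumes "r \<in> p_localized_ints p" "s \<in> p_localized_ints p" "p \<noteq> 0"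
  shows "r + s \<in> p_localized_ints p"
proof -
  obtain k n l m where "r = of_int k / of_nat p ^ n" "s = of_int l / of_nat p ^ m"
    using assms by (auto simp: p_localized_ints_def)
  then have "r + s = of_int (k * int p ^ m + l * int p ^ n) / of_nat p ^ (n + m)"
    using assms(3) by (simp add: add_divide_distrib power_add)
  then show ?thesis by (rule p_localized_intsI)
qed

lemma p_localized_ints_minus: "r \<in> p_localized_ints p \<Longrightarrow> - r \<in> p_localized_ints p"
  by (auto simp: p_localized_ints_def) (metis minus_divide_left of_int_minus)

lemma p_localized_ints_diff:
  "r \<in> p_localized_ints p \<Longrightarrow> s \<in> p_localized_ints p \<Longrightarrow> p \<noteq> 0 \<Longrightarrow> r - s \<in> p_localized_ints p"
  using p_localized_ints_add[of r p "- s"] p_localized_ints_minus by simp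

lemma p_localized_ints_sum:
  "p \<noteq> 0 \<Longrightarrow> (\<And>i. i \<in> I \<Longrightarrow> f i \<in> p_localized_ints p) \<Longrightarrow> sum f I \<in> p_localized_ints p"
  by (induction I rule: infinite_finite_induct)
    (auto intro: p_localized_ints_add p_localized_ints_of_int[of 0, simplified])

lemma p_localized_ints_integral:
  assumes "r \<in> p_localized_ints CARD('p::prime_card)" "padic_norm (of_rat r :: 'p padic) \<le> 1"
  shows "r \<in> \<int>"
proof -
  obtain k n where r: "r = of_int k / of_nat CARD('p) ^ n"
    using assms(1) by (auto simp: p_localized_ints_def)
  have "(of_rat r :: 'p padic) = of_int k * p_pow (- int n)"
    by (simp add: r of_rat_divide of_rat_power power_int_minus field_simps)
  then have "padic_norm (of_int k :: 'p padic) \<le> real CARD('p) powi (- int n)"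
    using assms(2) padic_norm_mult_p_pow_le_iff[of "of_int k :: 'p padic" "- int n" 0] by simp
  then obtain l where "k = int CARD('p) ^ n * l"
    unfolding padic_norm_of_int_le_iff by blast
  then have "r = of_int l" by (simp add: r)
  then show ?thesis by simp
qed

lemma digit_sum_lt_1:
  fixes d :: "int \<Rightarrow> nat"
  assumes "\<forall>j\<ge>\<gamma>. d j < p" "0 < p"
  shows "(\<Sum>j\<in>{\<gamma>..-1}. of_nat (d j) * of_nat p powi j :: rat) < 1"
proof -
  have *: "(\<Sum>j\<in>{- int m..-1}. of_nat (d j) * of_nat p powi j :: rat) \<le> 1 - of_nat p powi (- int m)"
    if "\<gamma> \<le> - int m" for m
    using that
  proof (induction m)
    case (Suc m)
    let ?j = "- int (Suc m)"
    have "{?j..-1} = insert ?j {- int m..-1}" by auto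
    then have "(\<Sum>j\<in>{?j..-1}. of_nat (d j) * of_nat p powi j :: rat)
        = of_nat (d ?j) * of_nat p powi ?j + (\<Sum>j\<in>{- int m..-1}. of_nat (d j) * of_nat p powi j)"
      by simp
    also have "\<dots> \<le> (of_nat p - 1) * of_nat p powi ?j + (1 - of_nat p powi (- int m))"
    proof (intro add_mono mult_right_mono)
      have "d ?j + 1 \<le> p" using assms(1) Suc.prems by (simp add: Suc_leI)
      then have "rat_of_nat (d ?j + 1) \<le> of_nat p" by (simp only: of_nat_le_iff)
      then show "of_nat (d ?j) \<le> (of_nat p - 1 :: rat)" by simp
    qed (use Suc in auto)
    also have "of_nat p powi (- int m) = of_nat p powi 1 * (of_nat p powi ?j :: rat)"
      using assms(2) by (subst power_int_add[symmetric]) auto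
    finally show ?case by (simp add: algebra_simps)
  qed simp
  show ?thesis
  proof (cases "\<gamma> \<ge> 0")
    case False
    have "0 < (of_nat p :: rat) powi \<gamma>" using assms(2) by simp
    then show ?thesis using *[of "nat (- \<gamma>)"] False by simp
  qed simp
qed

lemma of_rat_CARD_powi: "(of_rat (of_nat CARD('p) powi j) :: 'p::prime_card padic) = p_pow j"
  by (simp add: power_int_def of_rat_power of_rat_inverse)

text \<open>The terms with nonnegative exponent are integers, and so is the limit of their partial sums.\<close>

lemma digit_expansion_fractional_part:
  fixes x :: "'p::prime_card padic"
  assumes "digit_expansion x \<gamma> d"
  defines "r \<equiv> (\<Sum>j\<in>{\<gamma>..-1}. of_nat (d j) * of_nat CARD('p) powi j)"
  shows "r \<in> p_localized_ints CARD('p)" "0 \<le> r" "r < 1" "padic_norm (x - of_rat r) \<le> 1"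
proof -
  have d: "\<forall>j\<ge>\<gamma>. d j < CARD('p)"
    and lim: "(\<lambda>n. \<Sum>j\<in>{\<gamma>..<\<gamma> + int n}. of_nat (d j) * p_pow j) \<longlonglongrightarrow> x"
    using assms(1) by (auto simp: digit_expansion_def)
  show "r \<in> p_localized_ints CARD('p)"
    unfolding r_def
  proof (rule p_localized_ints_sum)
    fix j assume "j \<in> {\<gamma>..-1}"
    then show "of_nat (d j) * of_nat CARD('p) powi j \<in> p_localized_ints CARD('p)"
      by (intro p_localized_intsI[of _ "int (d j)" _ "nat (- j)"])
        (simp add: power_int_def divide_inverse power_inverse)
  qed simp
  show "0 \<le> r" unfolding r_def by (intro sum_nonneg) simp
  show "r < 1" unfolding r_def using d by (intro digit_sum_lt_1) auto
  have "padic_norm ((\<Sum>j\<in>{\<gamma>..<\<gamma> + int n}. of_nat (d j) * p_pow j) - (of_rat r :: 'p padic)) \<le> 1"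
    if "\<gamma> + int n \<ge> 0" for n
  proof -
    have r: "(of_rat r :: 'p padic) = (\<Sum>j\<in>{\<gamma>..-1}. of_nat (d j) * p_pow j)"
      by (simp add: r_def of_rat_sum of_rat_mult of_rat_CARD_powi)
    have "{\<gamma>..<\<gamma> + int n} = {\<gamma>..-1} \<union> {max \<gamma> 0..<\<gamma> + int n}" using that by auto
    then have eq: "(\<Sum>j\<in>{\<gamma>..<\<gamma> + int n}. of_nat (d j) * p_pow j) - (of_rat r :: 'p padic)
       = (\<Sum>j\<in>{max \<gamma> 0..<\<gamma> + int n}. of_nat (d j) * p_pow j)"
      unfolding r by (simp only:) (subst sum.union_disjoint; auto)
    have "padic_norm (\<Sum>j\<in>{max \<gamma> 0..<\<gamma> + int n}. of_nat (d j) * p_pow j :: 'p padic) \<le> 1"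
    proof (rule padic_norm_sum_le)
      fix j assume "j \<in> {max \<gamma> 0..<\<gamma> + int n}"
      then show "padic_norm (of_nat (d j) * p_pow j :: 'p padic) \<le> 1"
        using padic_norm_mult_p_pow_le_iff[of "of_nat (d j) :: 'p padic" j 0]
          order_trans[OF padic_norm_of_nat_le_1[of "d j", where 'p='p], of "real CARD('p) powi j"]
          CARD_powi_le_iff[of 0 j, where 'p='p]
        by simp
    qed simp
    then show ?thesis by (simp only: eq)
  qed
  then have "\<forall>\<^sub>F n in sequentially.
      dist (\<Sum>j\<in>{\<gamma>..<\<gamma> + int n}. of_nat (d j) * p_pow j) (of_rat r :: 'p padic) \<le> 1"
    unfolding dist_padic_def eventually_sequentially by (intro exI[of _ "nat (- \<gamma>)"]) auto
  then have "dist x (of_rat r) \<le> 1"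
    using lim by (intro tendsto_upperbound[OF tendsto_dist[OF lim tendsto_const]]) auto
  then show "padic_norm (x - of_rat r) \<le> 1" by (simp add: dist_padic_def)
qed

text \<open>The difference of two candidates is an element of \<open>\<int>[1/p]\<close> that is a \<open>p\<close>-adic integer, hence
  a rational integer; its real absolute value is less than one. In particular the description in
  \<open>padic_frac\<close> has only one solution.\<close>

lemma fractional_part_unique:
  fixes x :: "'p::prime_card padic"
  assumes r: "r \<in> p_localized_ints CARD('p)" "0 \<le> r" "r < 1" "padic_norm (x - of_rat r) \<le> 1"
    and s: "s \<in> p_localized_ints CARD('p)" "0 \<le> s" "s < 1" "padic_norm (x - of_rat s) \<le> 1"
  shows "r = s"
proof -
  have "padic_norm (of_rat (r - s) :: 'p padic) \<le> 1"
    using padic_norm_diff_le[OF s(4) r(4)] by (simp add: of_rat_diff)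
  then obtain k where "r - s = of_int k"
    using p_localized_ints_integral[of "r - s", where 'p='p] p_localized_ints_diff[OF r(1) s(1)]
    by (auto elim: Ints_cases)
  moreover from this have "of_int k < rat_of_int 1" "of_int k > rat_of_int (- 1)"
    using r s by simp_all
  then have "k < 1" "k > - 1" by (simp_all only: of_int_less_iff)
  ultimately show ?thesis by simp
qed

lemma padic_frac:
  fixes x :: "'p::prime_card padic"
  shows "padic_frac x \<in> p_localized_ints CARD('p)" "0 \<le> padic_frac x" "padic_frac x < 1"
    "padic_norm (x - of_rat (padic_frac x)) \<le> 1"
proof -
  let ?P = "\<lambda>r :: rat. \<exists>\<gamma> d. digit_expansion x \<gamma> d \<and>
     r = (\<Sum>j\<in>{\<gamma>..-1}. of_nat (d j) * of_nat CARD('p) powi j)"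
  have P: "r \<in> p_localized_ints CARD('p) \<and> 0 \<le> r \<and> r < 1 \<and> padic_norm (x - of_rat r) \<le> 1"
    if "?P r" for r
    using that digit_expansion_fractional_part by blast
  have "?P (padic_frac x)"
    unfolding padic_frac_def
  proof (rule theI')
    show "\<exists>!r. ?P r"
    proof (rule ex_ex1I)
      show "\<exists>r. ?P r" using digit_expansion_exists[of x] by blast
      fix r s assume "?P r" "?P s"
      then show "r = s"
        using P[of r] P[of s] fractional_part_unique[of r x s] by blast
    qed
  qed
  then show "padic_frac x \<in> p_localized_ints CARD('p)" "0 \<le> padic_frac x" "padic_frac x < 1"
    "padic_norm (x - of_rat (padic_frac x)) \<le> 1"
    using P by blast+
qed

lemma padic_frac_eqI:
  fixes x :: "'p::prime_card padic"
  assumes "r \<in> p_localized_ints CARD('p)" "0 \<le> r" "r < 1" "padic_norm (x - of_rat r) \<le> 1"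
  shows "padic_frac x = r"
  using fractional_part_unique[OF padic_frac assms] .

lemma of_rat_padic_frac_in_I_p: "of_rat (padic_frac (b :: 'p::prime_card padic)) \<in> (I_p :: 'p padic set)"
proof -
  have "padic_frac (of_rat (padic_frac b) :: 'p padic) = padic_frac b"
    using padic_frac[of b] by (intro padic_frac_eqI) auto
  then show ?thesis by (simp add: I_p_def)
qed

lemma nat_fraction_in_I_p:
  assumes "j < CARD('p::prime_card) ^ L"
  shows "of_nat j * p_pow (- int L) \<in> (I_p :: 'p padic set)"
proof -
  define r where "r = rat_of_nat j / of_nat CARD('p) ^ L"
  have r: "(of_nat j * p_pow (- int L) :: 'p padic) = of_rat r"
    by (simp add: r_def of_rat_divide of_rat_power power_int_minus field_simps)
  have "rat_of_nat j < of_nat (CARD('p) ^ L)" using assms by (simp only: of_nat_less_iff)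
  then have "padic_frac (of_rat r :: 'p padic) = r"
    by (intro padic_frac_eqI p_localized_intsI[of _ "int j" _ L]) (simp_all add: r_def)
  then show ?thesis by (simp add: I_p_def r)
qed

lemma complex_of_rat_eq: "complex_of_rat r = of_real (of_rat r)"
  by (cases r) (simp add: of_rat_rat)

text \<open>The character may be computed from any representative of \<open>x\<close> modulo \<open>\<int>\<^sub>p\<close> in \<open>\<int>[1/p]\<close>, since
  two of them differ by a rational integer. Without the range condition \<open>0 \<le> r < 1\<close>,
  representatives can be added, and additivity of the character follows.\<close>

lemma padic_char_eqI:
  fixes x :: "'p::prime_card padic"
  assumes "r \<in> p_localized_ints CARD('p)" "padic_norm (x - of_rat r) \<le> 1"
  shows "padic_char x = exp (2 * of_real pi * \<i> * of_rat r)"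
proof -
  have "padic_norm (of_rat (padic_frac x - r) :: 'p padic) \<le> 1"
    using padic_norm_diff_le[OF assms(2) padic_frac(4)[of x]] by (simp add: of_rat_diff)
  then obtain k where "padic_frac x - r = of_int k"
    using p_localized_ints_integral[of "padic_frac x - r", where 'p='p]
      p_localized_ints_diff[OF padic_frac(1)[of x] assms(1)]
    by (auto elim: Ints_cases)
  then have k: "padic_frac x = r + of_int k" by simp
  have "exp (2 * of_real pi * \<i> * of_int k) = (1::complex)"
    using exp_integer_2pi[of "of_int k"] by (simp add: mult_ac)
  then show ?thesis
    by (simp add: padic_char_def k of_rat_add distrib_left exp_add)
qed

lemma padic_char_add: "padic_char (x + y :: 'p::prime_card padic) = padic_char x * padic_char y"
proof -
  have "padic_norm ((x - of_rat (padic_frac x)) + (y - of_rat (padic_frac y))) \<le> 1"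
    by (intro padic_norm_add_le padic_frac)
  then have "padic_char (x + y) = exp (2 * of_real pi * \<i> * of_rat (padic_frac x + padic_frac y))"
    by (intro padic_char_eqI p_localized_ints_add padic_frac(1)) (auto simp: of_rat_add algebra_simps)
  then show ?thesis by (simp add: padic_char_def of_rat_add distrib_left exp_add)
qed

lemma padic_char_eq_1_iff: "padic_char (x :: 'p::prime_card padic) = 1 \<longleftrightarrow> padic_norm x \<le> 1"
proof
  assume "padic_norm x \<le> 1"
  then have "padic_char x = exp (2 * of_real pi * \<i> * of_rat 0)"
    by (intro padic_char_eqI p_localized_ints_of_int[of 0, simplified]) auto
  then show "padic_char x = 1" by simp
next
  assume "padic_char x = 1"
  then obtain k where "2 * pi * real_of_rat (padic_frac x) = of_int (2 * k) * pi"
    unfolding padic_char_def exp_eq_1 complex_of_rat_eq by auto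
  then have "real_of_rat (padic_frac x) = real_of_rat (of_int k)" by simp
  then have k: "padic_frac x = of_int k" by (simp only: of_rat_eq_iff)
  with padic_frac(2,3)[of x] have "k \<ge> 0" "k < 1" by simp_all
  then have "padic_frac x = 0" using k by simp
  then show "padic_norm x \<le> 1" using padic_frac(4)[of x] by simp
qed

lemma padic_char_0 [simp]: "padic_char (0 :: 'p::prime_card padic) = 1"
  by (simp add: padic_char_eq_1_iff)

lemma norm_padic_char [simp]: "cmod (padic_char x) = 1"
  unfolding padic_char_def complex_of_rat_eq by simp

lemma padic_char_mult_minus: "padic_char x * padic_char (- x :: 'p::prime_card padic) = 1"
  using padic_char_add[of x "- x"] by simp

lemma cnj_padic_char: "cnj (padic_char x) = padic_char (- x :: 'p::prime_card padic)"
proof -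
  have "padic_char x * cnj (padic_char x) = padic_char x * padic_char (- x)"
    unfolding padic_char_mult_minus complex_norm_square[symmetric] by simp
  moreover have "padic_char x \<noteq> 0" using norm_padic_char[of x] by force
  ultimately show ?thesis by simp
qed

lemma padic_char_of_nat_mult: "padic_char (of_nat n * x :: 'p::prime_card padic) = padic_char x ^ n"
  proof (induction n)
  case (Suc n)
  have "of_nat (Suc n) * x = x + of_nat n * x" by (simp add: distrib_right)
  then show ?case using Suc by (simp only: padic_char_add power_Suc)
qed simp

section \<open>Orthonormal systems of square-integrable functions\<close>

lemma borel_measurable_cnj: "f \<in> borel_measurable M \<Longrightarrow> (\<lambda>x. cnj (f x)) \<in> borel_measurable M"
  by (rule measurable_compose[OF _ borel_measurable_continuous_onI]) (auto intro: continuous_intros)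

lemma L2_inner_integrable:
  assumes "f \<in> L2 \<mu>" "g \<in> L2 \<mu>"
  shows "integrable \<mu> (\<lambda>x. f x * cnj (g x))"
proof (rule Bochner_Integration.integrable_bound)
  show "integrable \<mu> (\<lambda>x. (cmod (f x))\<^sup>2 + (cmod (g x))\<^sup>2)"
    using assms by (auto simp: L2_def)
  show "(\<lambda>x. f x * cnj (g x)) \<in> borel_measurable \<mu>"
    using assms by (auto simp: L2_def intro!: borel_measurable_times borel_measurable_cnj)
  have "a * b \<le> a\<^sup>2 + b\<^sup>2" for a b :: real
    using sum_squares_bound[of a b] zero_le_power2[of a] zero_le_power2[of b] by linarith
  then show "AE x in \<mu>. norm (f x * cnj (g x)) \<le> norm ((cmod (f x))\<^sup>2 + (cmod (g x))\<^sup>2)"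
    by (simp add: norm_mult)
qed

lemma L2_add:
  assumes "f \<in> L2 \<mu>" "g \<in> L2 \<mu>"
  shows "(\<lambda>x. f x + g x) \<in> L2 \<mu>"
proof -
  have "integrable \<mu> (\<lambda>x. (cmod (f x + g x))\<^sup>2)"
  proof (rule Bochner_Integration.integrable_bound)
    show "integrable \<mu> (\<lambda>x. 2 * (cmod (f x))\<^sup>2 + 2 * (cmod (g x))\<^sup>2)"
      using assms by (auto simp: L2_def)
    show "(\<lambda>x. (cmod (f x + g x))\<^sup>2) \<in> borel_measurable \<mu>"
      using assms by (auto simp: L2_def)
    have "(cmod (f x + g x))\<^sup>2 \<le> 2 * (cmod (f x))\<^sup>2 + 2 * (cmod (g x))\<^sup>2" for x
    proof -
      have "(cmod (f x + g x))\<^sup>2 \<le> (cmod (f x) + cmod (g x))\<^sup>2"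
        by (intro power_mono norm_triangle_ineq) simp
      also have "\<dots> \<le> 2 * (cmod (f x))\<^sup>2 + 2 * (cmod (g x))\<^sup>2"
        using sum_squares_bound[of "cmod (f x)" "cmod (g x)"] by (simp add: power2_sum)
      finally show ?thesis .
    qed
    then show "AE x in \<mu>. norm ((cmod (f x + g x))\<^sup>2) \<le> norm (2 * (cmod (f x))\<^sup>2 + 2 * (cmod (g x))\<^sup>2)"
      by simp
  qed
  then show ?thesis using assms by (auto simp: L2_def)
qed

lemma L2_scale: "f \<in> L2 \<mu> \<Longrightarrow> (\<lambda>x. c * f x) \<in> L2 \<mu>"
  by (auto simp: L2_def norm_mult power_mult_distrib)

lemma L2_0: "(\<lambda>x. 0) \<in> L2 \<mu>"
  by (simp add: L2_def)

lemma L2_diff: "f \<in> L2 \<mu> \<Longrightarrow> g \<in> L2 \<mu> \<Longrightarrow> (\<lambda>x. f x - g x) \<in> L2 \<mu>"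
  using L2_add[OF _ L2_scale[of g \<mu> "- 1"]] by fastforce

lemma L2_sum: "(\<And>a. a \<in> F \<Longrightarrow> e a \<in> L2 \<mu>) \<Longrightarrow> (\<lambda>x. \<Sum>a\<in>F. c a * e a x) \<in> L2 \<mu>"
proof (induction F rule: infinite_finite_induct)
  case (insert b F)
  then have "(\<lambda>x. c b * e b x + (\<Sum>a\<in>F. c a * e a x)) \<in> L2 \<mu>"
    by (intro L2_add L2_scale) auto
  then show ?case using insert by simp
qed (simp_all add: L2_0)

lemma L2_inner_diff_left:
  "f \<in> L2 \<mu> \<Longrightarrow> g \<in> L2 \<mu> \<Longrightarrow> h \<in> L2 \<mu> \<Longrightarrow>
     L2_inner \<mu> (\<lambda>x. f x - g x) h = L2_inner \<mu> f h - L2_inner \<mu> g h"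
  by (simp add: L2_inner_def left_diff_distrib L2_inner_integrable)

lemma L2_inner_commute: "L2_inner \<mu> g f = cnj (L2_inner \<mu> f g)"
  unfolding L2_inner_def Bochner_Integration.integral_cnj[symmetric]
  by (intro Bochner_Integration.integral_cong refl) simp

lemma L2_inner_diff_right:
  "f \<in> L2 \<mu> \<Longrightarrow> g \<in> L2 \<mu> \<Longrightarrow> h \<in> L2 \<mu> \<Longrightarrow>
     L2_inner \<mu> h (\<lambda>x. f x - g x) = L2_inner \<mu> h f - L2_inner \<mu> h g"
proof -
  assume "f \<in> L2 \<mu>" "g \<in> L2 \<mu>" "h \<in> L2 \<mu>"
  then have "cnj (L2_inner \<mu> (\<lambda>x. f x - g x) h) = cnj (L2_inner \<mu> f h) - cnj (L2_inner \<mu> g h)"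
    by (simp add: L2_inner_diff_left)
  then show ?thesis by (simp only: L2_inner_commute[symmetric])
qed

lemma L2_inner_sum_left:
  assumes "\<And>a. a \<in> F \<Longrightarrow> e a \<in> L2 \<mu>" "h \<in> L2 \<mu>"
  shows "L2_inner \<mu> (\<lambda>x. \<Sum>a\<in>F. c a * e a x) h = (\<Sum>a\<in>F. c a * L2_inner \<mu> (e a) h)"
  using assms
  by (simp add: L2_inner_def sum_distrib_right mult.assoc L2_inner_integrable Bochner_Integration.integral_sum)

lemma L2_inner_sum_right:
  assumes "\<And>a. a \<in> F \<Longrightarrow> e a \<in> L2 \<mu>" "h \<in> L2 \<mu>"
  shows "L2_inner \<mu> h (\<lambda>x. \<Sum>a\<in>F. c a * e a x) = (\<Sum>a\<in>F. cnj (c a) * L2_inner \<mu> h (e a))"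
proof -
  have "cnj (L2_inner \<mu> (\<lambda>x. \<Sum>a\<in>F. c a * e a x) h) = (\<Sum>a\<in>F. cnj (c a) * cnj (L2_inner \<mu> (e a) h))"
    using assms by (simp add: L2_inner_sum_left)
  then show ?thesis by (simp only: L2_inner_commute[symmetric])
qed

lemma L2_inner_self: "L2_inner \<mu> f f = of_real ((L2_norm \<mu> f)\<^sup>2)"
  by (simp only: L2_inner_def L2_norm_def complex_norm_square[symmetric] integral_complex_of_real) simp

text \<open>Pythagoras: \<open>f - (\<Sum>a\<in>F. c a * e a)\<close> splits into the component of \<open>f\<close> orthogonal to the \<open>e a\<close>
  and a combination of the \<open>e a\<close>. With the inner products for \<open>c\<close>, this yields Bessel's inequality and
  its case of equality; for general \<open>c\<close>, it bounds the error of each single coefficient.\<close>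

lemma L2_norm_diff_sum:
  assumes F: "finite F" and f: "f \<in> L2 \<mu>" and e: "\<And>a. a \<in> F \<Longrightarrow> e a \<in> L2 \<mu>"
    and ortho: "\<And>a b. a \<in> F \<Longrightarrow> b \<in> F \<Longrightarrow> L2_inner \<mu> (e a) (e b) = (if a = b then 1 else 0)"
  shows "(L2_norm \<mu> (\<lambda>x. f x - (\<Sum>a\<in>F. c a * e a x)))\<^sup>2
    = (L2_norm \<mu> f)\<^sup>2 - (\<Sum>a\<in>F. (cmod (L2_inner \<mu> f (e a)))\<^sup>2)
        + (\<Sum>a\<in>F. (cmod (L2_inner \<mu> f (e a) - c a))\<^sup>2)"
proof -
  define s where "s = (\<lambda>x. \<Sum>a\<in>F. c a * e a x)"
  let ?z = "\<lambda>a. L2_inner \<mu> f (e a)"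
  have s: "s \<in> L2 \<mu>" unfolding s_def using e by (rule L2_sum)
  have fs: "L2_inner \<mu> f s = (\<Sum>a\<in>F. cnj (c a) * ?z a)"
    unfolding s_def using e f by (rule L2_inner_sum_right)
  have "L2_inner \<mu> s (e b) = c b" if "b \<in> F" for b
    using that F unfolding s_def by (simp add: L2_inner_sum_left e ortho if_distrib cong: if_cong)
  then have ss: "L2_inner \<mu> s s = (\<Sum>a\<in>F. cnj (c a) * c a)"
    unfolding s_def by (subst L2_inner_sum_right[OF e s[unfolded s_def]]) auto
  have "complex_of_real ((L2_norm \<mu> (\<lambda>x. f x - s x))\<^sup>2) = L2_inner \<mu> (\<lambda>x. f x - s x) (\<lambda>x. f x - s x)"
    by (simp only: L2_inner_self)
  also have "\<dots> = L2_inner \<mu> f f - L2_inner \<mu> f s - cnj (L2_inner \<mu> f s) + L2_inner \<mu> s s"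
    using f s by (simp add: L2_inner_diff_left L2_inner_diff_right L2_diff flip: L2_inner_commute)
  also have "\<dots> = of_real ((L2_norm \<mu> f)\<^sup>2) - (\<Sum>a\<in>F. ?z a * cnj (?z a))
      + (\<Sum>a\<in>F. (?z a - c a) * cnj (?z a - c a))"
  proof -
    have "(\<Sum>a\<in>F. (?z a - c a) * cnj (?z a - c a))
        = (\<Sum>a\<in>F. ?z a * cnj (?z a) - cnj (c a) * ?z a - c a * cnj (?z a) + cnj (c a) * c a)"
      by (intro sum.cong refl) (simp add: left_diff_distrib right_diff_distrib)
    also have "\<dots> = (\<Sum>a\<in>F. ?z a * cnj (?z a)) - L2_inner \<mu> f s - cnj (L2_inner \<mu> f s) + L2_inner \<mu> s s"
      unfolding fs ss by (simp add: sum_subtractf sum.distrib)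
    finally show ?thesis unfolding L2_inner_self[of \<mu> f] by simp
  qed
  also have "\<dots> = of_real ((L2_norm \<mu> f)\<^sup>2 - (\<Sum>a\<in>F. (cmod (?z a))\<^sup>2) + (\<Sum>a\<in>F. (cmod (?z a - c a))\<^sup>2))"
    by (simp only: of_real_add of_real_diff of_real_sum complex_norm_square)
  finally show ?thesis unfolding s_def of_real_eq_iff .
qed

lemma bessel_inequality:
  assumes "finite F" "f \<in> L2 \<mu>" "\<And>a. a \<in> F \<Longrightarrow> e a \<in> L2 \<mu>"
    "\<And>a b. a \<in> F \<Longrightarrow> b \<in> F \<Longrightarrow> L2_inner \<mu> (e a) (e b) = (if a = b then 1 else 0)"
  shows "(\<Sum>a\<in>F. (cmod (L2_inner \<mu> f (e a)))\<^sup>2) \<le> (L2_norm \<mu> f)\<^sup>2"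
  using L2_norm_diff_sum[OF assms, where c = "\<lambda>a. L2_inner \<mu> f (e a)"]
    zero_le_power2[of "L2_norm \<mu> (\<lambda>x. f x - (\<Sum>a\<in>F. L2_inner \<mu> f (e a) * e a x))"] by simp

lemma bessel_equality:
  assumes "finite F" "f \<in> L2 \<mu>" "\<And>a. a \<in> F \<Longrightarrow> e a \<in> L2 \<mu>"
    "\<And>a b. a \<in> F \<Longrightarrow> b \<in> F \<Longrightarrow> L2_inner \<mu> (e a) (e b) = (if a = b then 1 else 0)"
    and eq: "(\<Sum>a\<in>F. (cmod (L2_inner \<mu> f (e a)))\<^sup>2) = (L2_norm \<mu> f)\<^sup>2"
  shows "AE x in \<mu>. f x = (\<Sum>a\<in>F. L2_inner \<mu> f (e a) * e a x)"
proof -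
  let ?g = "\<lambda>x. f x - (\<Sum>a\<in>F. L2_inner \<mu> f (e a) * e a x)"
  have g: "?g \<in> L2 \<mu>" using assms by (intro L2_diff L2_sum)
  have "(L2_norm \<mu> ?g)\<^sup>2 = 0"
    using L2_norm_diff_sum[OF assms(1-4), where c = "\<lambda>a. L2_inner \<mu> f (e a)"] eq by simp
  then have "(\<integral>x. (cmod (?g x))\<^sup>2 \<partial>\<mu>) = 0" by (simp add: L2_norm_def)
  then have "AE x in \<mu>. (cmod (?g x))\<^sup>2 = 0"
    using g by (subst (asm) integral_nonneg_eq_0_iff_AE) (auto simp: L2_def)
  then show ?thesis by simp
qed

text \<open>Coefficients are determined by convergence in the mean alone: by Pythagoras and Bessel, the error of
  every partial sum whose index set contains \<open>a\<close> is at least the error of the coefficient at \<open>a\<close>.\<close>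

lemma L2_expansion_coefficient:
  assumes exp: "L2_expansion \<mu> I e c f" and f: "f \<in> L2 \<mu>" and e: "\<And>a. a \<in> I \<Longrightarrow> e a \<in> L2 \<mu>"
    and ortho: "\<And>a b. a \<in> I \<Longrightarrow> b \<in> I \<Longrightarrow> L2_inner \<mu> (e a) (e b) = (if a = b then 1 else 0)"
    and a: "a \<in> I"
  shows "c a = L2_inner \<mu> f (e a)"
proof -
  have "cmod (L2_inner \<mu> f (e a) - c a) \<le> L2_norm \<mu> (\<lambda>x. f x - (\<Sum>a\<in>F. c a * e a x))"
    if F: "finite F" "{a} \<subseteq> F" "F \<subseteq> I" for F
  proof -
    have "(cmod (L2_inner \<mu> f (e a) - c a))\<^sup>2 \<le> (\<Sum>b\<in>F. (cmod (L2_inner \<mu> f (e b) - c b))\<^sup>2)"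
      using F by (intro member_le_sum) auto
    also have "\<dots> \<le> (L2_norm \<mu> (\<lambda>x. f x - (\<Sum>a\<in>F. c a * e a x)))\<^sup>2"
    proof -
      have F': "\<And>a. a \<in> F \<Longrightarrow> e a \<in> L2 \<mu>"
        "\<And>a b. a \<in> F \<Longrightarrow> b \<in> F \<Longrightarrow> L2_inner \<mu> (e a) (e b) = (if a = b then 1 else 0)"
        using e ortho F(3) by blast+
      show ?thesis
        using L2_norm_diff_sum[OF F(1) f F', of c] bessel_inequality[OF F(1) f F'] by simp
    qed
    finally show ?thesis by (rule power2_le_imp_le) (simp add: L2_norm_def)
  qed
  then have "\<forall>\<^sub>F F in finite_subsets_at_top I.
      cmod (L2_inner \<mu> f (e a) - c a) \<le> L2_norm \<mu> (\<lambda>x. f x - (\<Sum>a\<in>F. c a * e a x))"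
    using a unfolding eventually_finite_subsets_at_top by (intro exI[of _ "{a}"]) auto
  then have "cmod (L2_inner \<mu> f (e a) - c a) \<le> 0"
    using exp unfolding L2_expansion_def by (intro tendsto_lowerbound) auto
  then show ?thesis by simp
qed

lemma L2_expansion_single:
  assumes "a \<in> I" "\<And>x. f x = c * e a x"
  shows "L2_expansion \<mu> I e (\<lambda>a'. if a' = a then c else 0) f"
proof -
  have "L2_norm \<mu> (\<lambda>x. f x - (\<Sum>a'\<in>F. (if a' = a then c else 0) * e a' x)) = 0"
    if "finite F" "{a} \<subseteq> F" "F \<subseteq> I" for F
  proof -
    have "(\<Sum>a'\<in>F. (if a' = a then c else 0) * e a' x) = f x" for x
    proof -
      have "(\<Sum>a'\<in>F. (if a' = a then c else 0) * e a' x) = (\<Sum>a'\<in>{a}. (if a' = a then c else 0) * e a' x)"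
        using that by (intro sum.mono_neutral_right) auto
      then show ?thesis by (simp add: assms(2))
    qed
    then show ?thesis by (simp add: L2_norm_def)
  qed
  then have "\<forall>\<^sub>F F in finite_subsets_at_top I.
      L2_norm \<mu> (\<lambda>x. f x - (\<Sum>a'\<in>F. (if a' = a then c else 0) * e a' x)) = 0"
    using assms(1) unfolding eventually_finite_subsets_at_top by (intro exI[of _ "{a}"]) auto
  then show ?thesis unfolding L2_expansion_def by (rule tendsto_eventually)
qed

section \<open>Haar measure\<close>

lemma padic_ball_eq_cball: "padic_ball \<gamma> c = cball c (real CARD('p) powi \<gamma>)"
  for c :: "'p::prime_card padic"
  by (auto simp: padic_ball_def cball_def dist_padic_def padic_norm_diff_commute)

lemma padic_ball_borel: "padic_ball \<gamma> c \<in> sets borel"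
  by (simp add: padic_ball_eq_cball)

lemma mem_padic_ball_0: "x \<in> padic_ball \<gamma> 0 \<longleftrightarrow> padic_norm x \<le> real CARD('p) powi \<gamma>"
  for x :: "'p::prime_card padic"
  by (simp add: padic_ball_def)

lemma add_in_padic_ball_0_iff:
  assumes "t \<in> padic_ball \<gamma> (0 :: 'p::prime_card padic)"
  shows "x + t \<in> padic_ball \<gamma> 0 \<longleftrightarrow> x \<in> padic_ball \<gamma> 0"
proof
  assume "x + t \<in> padic_ball \<gamma> 0"
  then have "padic_norm ((x + t) - t) \<le> real CARD('p) powi \<gamma>"
    using assms unfolding mem_padic_ball_0 by (rule padic_norm_diff_le)
  then show "x \<in> padic_ball \<gamma> 0" by (simp add: mem_padic_ball_0)
next
  assume "x \<in> padic_ball \<gamma> 0"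
  then show "x + t \<in> padic_ball \<gamma> 0"
    using assms unfolding mem_padic_ball_0 by (rule padic_norm_add_le)
qed

lemma borel_measurable_padic_add: "(\<lambda>x :: 'p::prime_card padic. x + t) \<in> borel_measurable borel"
proof (rule borel_measurable_continuous_onI, rule lipschitz_on_continuous_on)
  show "1-lipschitz_on UNIV (\<lambda>x :: 'p padic. x + t)"
    by (rule lipschitz_onI) (simp_all add: dist_padic_def)
qed

lemma borel_measurable_padic_mult: "(\<lambda>x :: 'p::prime_card padic. t * x) \<in> borel_measurable borel"
proof (rule borel_measurable_continuous_onI, rule lipschitz_on_continuous_on)
  show "(padic_norm t)-lipschitz_on UNIV (\<lambda>x :: 'p padic. t * x)"
    by (rule lipschitz_onI)
      (simp_all add: dist_padic_def padic_norm_nonneg padic_norm_mult flip: right_diff_distrib)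
qed

lemma continuous_on_locally_constant:
  fixes f :: "'a::metric_space \<Rightarrow> 'b::metric_space"
  assumes "\<And>x. \<exists>U. open U \<and> x \<in> U \<and> (\<forall>y\<in>U. f y = f x)"
  shows "continuous_on UNIV f"
  unfolding continuous_on_def
proof
  fix x :: 'a
  obtain U where "open U" "x \<in> U" "\<forall>y\<in>U. f y = f x" using assms by blast
  then have "\<forall>\<^sub>F y in at x. f y = f x"
    unfolding eventually_at_topological by blast
  then show "(f \<longlongrightarrow> f x) (at x within UNIV)" by (rule tendsto_eventually)
qed

lemma borel_measurable_padic_char: "padic_char \<in> borel_measurable (borel :: 'p::prime_card padic measure)"
proof (rule borel_measurable_continuous_onI, rule continuous_on_locally_constant)
  fix x :: "'p padic"
  have const: "padic_char y = padic_char x" if "y \<in> ball x 1" for y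
  proof -
    have "padic_char (y - x) = 1"
      using that by (simp add: padic_char_eq_1_iff dist_padic_def padic_norm_diff_commute)
    then show ?thesis using padic_char_add[of "y - x" x] by simp
  qed
  show "\<exists>U. open U \<and> x \<in> U \<and> (\<forall>y\<in>U. padic_char y = padic_char x)"
    by (intro exI[of _ "ball x 1"] conjI ballI open_ball const) simp_all
qed

text \<open>The elements \<open>j * p ^ (-g)\<close> with \<open>0 \<le> j < p ^ n\<close> represent the cosets of the subgroup of
  radius \<open>p ^ (g - n)\<close> in the one of radius \<open>p ^ g\<close>.\<close>

lemma padic_ball_partition:
  "padic_ball g (0 :: 'p::prime_card padic)
     = (\<Union>j<CARD('p) ^ n. padic_ball (g - int n) (of_nat j * p_pow (- g)))"
  "disjoint_family_on (\<lambda>j. padic_ball (g - int n) (of_nat j * p_pow (- g) :: 'p padic)) {..<CARD('p) ^ n}"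
proof -
  have iff: "x \<in> padic_ball (g - int n) (of_nat j * p_pow (- g))
      \<longleftrightarrow> padic_norm (x * p_pow g - of_nat j) \<le> real CARD('p) powi (- int n)" for x :: "'p padic" and j
  proof -
    have "x - of_nat j * p_pow (- g) = (x * p_pow g - of_nat j) * p_pow (- g)"
      by (simp only: left_diff_distrib mult.assoc p_pow_mult_inverse mult_1_right)
    moreover have "- g + (g - int n) = - int n" by simp
    ultimately show ?thesis
      unfolding padic_ball_def mem_Collect_eq by (simp only: padic_norm_mult_p_pow_le_iff)
  qed
  show "padic_ball g (0 :: 'p padic) = (\<Union>j<CARD('p) ^ n. padic_ball (g - int n) (of_nat j * p_pow (- g)))"
  proof (rule equalityI; rule subsetI)
    fix x :: "'p padic" assume "x \<in> padic_ball g 0"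
    then have "padic_norm (x * p_pow g) \<le> 1"
      using padic_norm_mult_p_pow_le_iff[of x g 0] by (simp add: mem_padic_ball_0)
    then obtain j where "j < CARD('p) ^ n" "padic_norm (x * p_pow g - of_nat j) \<le> real CARD('p) powi (- int n)"
      by (rule padic_integer_approx)
    then show "x \<in> (\<Union>j<CARD('p) ^ n. padic_ball (g - int n) (of_nat j * p_pow (- g)))"
      using iff by blast
  next
    fix x :: "'p padic" assume "x \<in> (\<Union>j<CARD('p) ^ n. padic_ball (g - int n) (of_nat j * p_pow (- g)))"
    then obtain j where j: "padic_norm (x * p_pow g - of_nat j) \<le> real CARD('p) powi (- int n)"
      using iff by blast
    have "real CARD('p) powi (- int n) \<le> real CARD('p) powi 0" by (subst CARD_powi_le_iff) simp
    then have "padic_norm (x * p_pow g) \<le> 1"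
      using padic_norm_add_le[of "x * p_pow g - of_nat j" 1 "of_nat j"] j padic_norm_of_nat_le_1[of j, where 'p='p]
      by simp
    then show "x \<in> padic_ball g 0"
      using padic_norm_mult_p_pow_le_iff[of x g 0] by (simp add: mem_padic_ball_0)
  qed
  show "disjoint_family_on (\<lambda>j. padic_ball (g - int n) (of_nat j * p_pow (- g) :: 'p padic)) {..<CARD('p) ^ n}"
    unfolding disjoint_family_on_def
  proof (intro ballI impI, rule ccontr)
    fix i j
    assume ij: "i \<in> {..<CARD('p) ^ n}" "j \<in> {..<CARD('p) ^ n}" "i \<noteq> j"
      and "padic_ball (g - int n) (of_nat i * p_pow (- g) :: 'p padic)
        \<inter> padic_ball (g - int n) (of_nat j * p_pow (- g)) \<noteq> {}"
    then obtain x :: "'p padic" where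
      "padic_norm (x * p_pow g - of_nat i) \<le> real CARD('p) powi (- int n)"
      "padic_norm (x * p_pow g - of_nat j) \<le> real CARD('p) powi (- int n)"
      using iff by blast
    from padic_norm_diff_le[OF this]
    have "padic_norm (of_int (int j - int i) :: 'p padic) \<le> real CARD('p) powi (- int n)" by simp
    then have "int (CARD('p) ^ n) dvd int j - int i" by (simp only: padic_norm_of_int_le_iff of_nat_power)
    then have "int j mod int (CARD('p) ^ n) = int i mod int (CARD('p) ^ n)"
      by (simp only: mod_eq_dvd_iff)
    with ij show False by (simp flip: of_nat_mod of_nat_power)
  qed
qed

locale normalized_haar_measure =
  fixes \<mu> :: "'p::prime_card padic measure"
  assumes normalized_haar: "normalized_haar \<mu>"
begin

lemma sets_haar [measurable_cong, simp]: "sets \<mu> = sets borel"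
  using normalized_haar unfolding normalized_haar_def by (rule conjunct1)

lemma haar_invariant: "A \<in> sets \<mu> \<Longrightarrow> emeasure \<mu> ((\<lambda>x. a + x) ` A) = emeasure \<mu> A"
  using normalized_haar unfolding normalized_haar_def by blast

lemma emeasure_unit_ball: "emeasure \<mu> (padic_ball 0 0) = 1"
proof -
  have "padic_ball 0 0 = (padic_integers :: 'p padic set)"
    by (simp add: padic_ball_def padic_integers_def)
  then show ?thesis using normalized_haar unfolding normalized_haar_def by (simp only: simp_thms)
qed

lemma space_haar [simp]: "space \<mu> = UNIV"
  using sets_eq_imp_space_eq[OF sets_haar] by (simp only: space_borel)

lemma borel_measurable_haar: "borel_measurable \<mu> = borel_measurable borel"
  by (rule measurable_cong_sets[OF sets_haar refl])

lemma measurable_translation: "(\<lambda>x. x + t) \<in> measurable \<mu> \<mu>"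
  unfolding measurable_cong_sets[OF sets_haar sets_haar] by (rule borel_measurable_padic_add)

lemma measurable_character: "(\<lambda>x. padic_char (\<xi> * x)) \<in> borel_measurable \<mu>"
  unfolding borel_measurable_haar
  using measurable_compose[OF borel_measurable_padic_mult borel_measurable_padic_char] .

lemma measurable_ball: "padic_ball \<gamma> c \<in> sets \<mu>"
  by (simp add: padic_ball_borel)

lemma distr_translation: "distr \<mu> \<mu> (\<lambda>x. x + t) = \<mu>"
proof (rule measure_eqI)
  fix A assume "A \<in> sets (distr \<mu> \<mu> (\<lambda>x. x + t))"
  then have A: "A \<in> sets \<mu>" by simp
  have "(\<lambda>x. x + t) -` A = (\<lambda>x. - t + x) ` A"
  proof (rule equalityI; rule subsetI)
    fix x assume "x \<in> (\<lambda>x. x + t) -` A"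
    then show "x \<in> (\<lambda>x. - t + x) ` A" by (intro image_eqI[of _ _ "x + t"]) auto
  qed auto
  then show "emeasure (distr \<mu> \<mu> (\<lambda>x. x + t)) A = emeasure \<mu> A"
    using A haar_invariant[OF A, of "- t"] by (simp only: emeasure_distr[OF measurable_translation] space_haar Int_UNIV_right)
qed simp

lemma integral_translation:
  fixes f :: "'p padic \<Rightarrow> complex"
  assumes "f \<in> borel_measurable \<mu>"
  shows "(\<integral>x. f (x + t) \<partial>\<mu>) = (\<integral>x. f x \<partial>\<mu>)"
  using integral_distr[OF measurable_translation assms, of t] unfolding distr_translation by (rule sym)

lemma emeasure_ball_translate: "emeasure \<mu> (padic_ball \<gamma> c) = emeasure \<mu> (padic_ball \<gamma> 0)"
proof -
  have "padic_ball \<gamma> c = (\<lambda>x. c + x) ` padic_ball \<gamma> 0"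
  proof (rule equalityI; rule subsetI)
    fix x assume "x \<in> padic_ball \<gamma> c"
    then show "x \<in> (\<lambda>x. c + x) ` padic_ball \<gamma> 0"
      by (intro image_eqI[of _ _ "x - c"]) (auto simp: padic_ball_def)
  qed (auto simp: padic_ball_def)
  then show ?thesis
    by (simp only: haar_invariant[OF measurable_ball])
qed

lemma emeasure_ball_subdivide:
  "emeasure \<mu> (padic_ball g 0) = of_nat (CARD('p) ^ n) * emeasure \<mu> (padic_ball (g - int n) 0)"
proof -
  have "emeasure \<mu> (padic_ball g 0)
      = (\<Sum>j<CARD('p) ^ n. emeasure \<mu> (padic_ball (g - int n) (of_nat j * p_pow (- g))))"
    unfolding padic_ball_partition(1)[of g n, where 'p='p]
    by (intro sum_emeasure[symmetric] padic_ball_partition(2)) (auto simp: padic_ball_borel)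
  also have "\<dots> = (\<Sum>j<CARD('p) ^ n. emeasure \<mu> (padic_ball (g - int n) 0))"
    by (intro sum.cong refl emeasure_ball_translate)
  finally show ?thesis by simp
qed

text \<open>The subdivision relates every radius \<open>p ^ \<gamma>\<close> to the unit ball: large balls consist of
  translates of it, and it consists of translates of small balls.\<close>

lemma emeasure_ball: "emeasure \<mu> (padic_ball \<gamma> c) = ennreal (real CARD('p) powi \<gamma>)"
proof -
  show ?thesis
  proof (cases "\<gamma> \<ge> 0")
    case True
    then show ?thesis
      using emeasure_ball_subdivide[of \<gamma> "nat \<gamma>"] emeasure_unit_ball
      by (simp add: emeasure_ball_translate[of \<gamma> c] power_int_def ennreal_of_nat_eq_real_of_nat
          flip: ennreal_power)
  next
    case False
    define n where "n = nat (- \<gamma>)"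
    have \<gamma>: "\<gamma> = - int n" using False by (simp add: n_def)
    have eq: "ennreal (real (CARD('p) ^ n)) * emeasure \<mu> (padic_ball \<gamma> 0) = 1"
      using emeasure_ball_subdivide[of 0 n] emeasure_unit_ball by (simp add: \<gamma> ennreal_of_nat_eq_real_of_nat)
    obtain r where r: "r \<ge> 0" "emeasure \<mu> (padic_ball \<gamma> 0) = ennreal r"
      using eq by (cases "emeasure \<mu> (padic_ball \<gamma> 0)") (auto simp: ennreal_mult_top split: if_splits)
    have "ennreal (real (CARD('p) ^ n) * r) = ennreal 1"
      using eq r by (simp add: ennreal_mult)
    then have "real (CARD('p) ^ n) * r = 1" using r(1) by (subst (asm) ennreal_inj) auto
    then have "r = real CARD('p) powi \<gamma>" by (simp add: \<gamma> power_int_minus field_simps)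
    then show ?thesis by (simp add: emeasure_ball_translate[of \<gamma> c] r)
  qed
qed

lemma measure_ball: "measure \<mu> (padic_ball \<gamma> c) = real CARD('p) powi \<gamma>"
  by (simp add: measure_def emeasure_ball)

lemma integrable_indicator_ball: "integrable \<mu> (indicator (padic_ball \<gamma> c) :: _ \<Rightarrow> real)"
  by (rule integrable_real_indicator) (simp_all add: emeasure_ball padic_ball_borel)

lemma L2_supported_on_ball_integrable:
  assumes f: "f \<in> L2 \<mu>" and supp: "\<And>x. x \<notin> padic_ball \<gamma> c \<Longrightarrow> f x = 0"
  shows "integrable \<mu> f"
proof (rule Bochner_Integration.integrable_bound)
  show "integrable \<mu> (\<lambda>x. indicator (padic_ball \<gamma> c) x + (cmod (f x))\<^sup>2)"
    using f by (intro Bochner_Integration.integrable_add integrable_indicator_ball) (simp add: L2_def)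
  have "cmod (f x) \<le> indicator (padic_ball \<gamma> c) x + (cmod (f x))\<^sup>2" for x
  proof (cases "x \<in> padic_ball \<gamma> c")
    case True
    have "2 * cmod (f x) \<le> 1 + (cmod (f x))\<^sup>2"
      using sum_squares_bound[of 1 "cmod (f x)"] by simp
    then have "cmod (f x) \<le> 1 + (cmod (f x))\<^sup>2" using norm_ge_zero[of "f x"] by linarith
    then show ?thesis using True by simp
  qed (simp add: supp)
  then show "AE x in \<mu>. norm (f x) \<le> norm (indicator (padic_ball \<gamma> c) x + (cmod (f x))\<^sup>2 :: real)"
    by (intro AE_I2) (simp add: indicator_def)
qed (use f in \<open>simp add: L2_def\<close>)

lemma integrable_character_mult:
  assumes "integrable \<mu> f"
  shows "integrable \<mu> (\<lambda>x. padic_char (\<xi> * x) * f x)"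
  using assms measurable_character[of \<xi>]
  by (intro Bochner_Integration.integrable_bound[OF assms]) (auto simp: norm_mult)

text \<open>Translating by \<open>p ^ (-\<gamma>)\<close> preserves the ball of radius \<open>p ^ \<gamma>\<close> and multiplies the integrand by a
  constant different from one.\<close>

lemma integral_character_ball:
  assumes "\<not> padic_norm \<eta> \<le> real CARD('p) powi (- \<gamma>)"
  shows "(\<integral>x. padic_char (\<eta> * x) * indicator (padic_ball \<gamma> 0) x \<partial>\<mu>) = 0"
proof -
  let ?f = "\<lambda>x. padic_char (\<eta> * x) * indicator (padic_ball \<gamma> 0) x"
  let ?t = "p_pow (- \<gamma>) :: 'p padic"
  have t: "?t \<in> padic_ball \<gamma> 0" by (simp add: mem_padic_ball_0)
  have "padic_char (\<eta> * ?t) \<noteq> 1"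
    using assms padic_norm_mult_p_pow_le_iff[of \<eta> "- \<gamma>" 0] by (simp add: padic_char_eq_1_iff)
  moreover have "(\<integral>x. ?f x \<partial>\<mu>) = padic_char (\<eta> * ?t) * (\<integral>x. ?f x \<partial>\<mu>)"
  proof -
    have "?f \<in> borel_measurable \<mu>"
      using measurable_character[of \<eta>] measurable_ball[of \<gamma> 0] by measurable
    then have "(\<integral>x. ?f x \<partial>\<mu>) = (\<integral>x. ?f (x + ?t) \<partial>\<mu>)" by (rule integral_translation[of ?f ?t, symmetric])
    also have "\<dots> = (\<integral>x. padic_char (\<eta> * ?t) * ?f x \<partial>\<mu>)"
      using add_in_padic_ball_0_iff[OF t]
      by (intro Bochner_Integration.integral_cong refl)
        (simp add: distrib_left padic_char_add indicator_def del: padic_norm_p_pow)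
    finally show ?thesis by simp
  qed
  ultimately show ?thesis by simp
qed

end

section \<open>Character sums and Fourier inversion\<close>

lemma sum_powers_root_of_unity:
  fixes \<omega> :: complex
  assumes "\<omega> ^ n = 1" "\<omega> \<noteq> 1"
  shows "(\<Sum>j<n. \<omega> ^ j) = 0"
  using power_diff_1_eq[of \<omega> n] assms by simp

lemma padic_char_fraction:
  "padic_char (of_nat j * p_pow k * x :: 'p::prime_card padic) = padic_char (p_pow k * x) ^ j"
  by (simp only: mult.assoc padic_char_of_nat_mult)

text \<open>The frequencies \<open>m * p ^ (-M)\<close> with \<open>m < p ^ (M + L)\<close> represent the dual of the finite group
  \<open>B\<^sub>L(0) / B\<^sub>-\<^sub>M(0)\<close>; this is orthogonality of its characters.\<close>

lemma sum_padic_char_fractions: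
  fixes u :: "'p::prime_card padic"
  assumes "padic_norm u \<le> real CARD('p) powi int L"
  shows "(\<Sum>m<CARD('p) ^ (M + L). padic_char (of_nat m * p_pow (- int M) * u))
    = (if padic_norm u \<le> real CARD('p) powi (- int M) then of_nat (CARD('p) ^ (M + L)) else 0)"
proof -
  define \<omega> where "\<omega> = padic_char (p_pow (- int M) * u)"
  have \<omega>: "\<omega> = 1 \<longleftrightarrow> padic_norm u \<le> real CARD('p) powi (- int M)"
    using padic_norm_mult_p_pow_le_iff[of u "- int M" 0]
    by (simp add: \<omega>_def padic_char_eq_1_iff mult.commute)
  have "\<omega> ^ CARD('p) ^ (M + L) = padic_char (u * p_pow (int L))"
  proof -
    have "(of_nat (CARD('p) ^ (M + L)) :: 'p padic) = p_pow (int L) * p_pow (int M)"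
      by (simp add: power_add mult.commute)
    then have "of_nat (CARD('p) ^ (M + L)) * (p_pow (- int M) * u) = p_pow (int L) * (p_pow (int M) * p_pow (- int M)) * u"
      by (simp only: mult.assoc)
    also have "\<dots> = u * p_pow (int L)"
      by (simp only: p_pow_mult_inverse mult_1_right) (rule mult.commute)
    finally show ?thesis unfolding \<omega>_def padic_char_of_nat_mult[symmetric] by (rule arg_cong)
  qed
  also have "\<dots> = 1"
    using assms padic_norm_mult_p_pow_le_iff[of u "int L" 0] by (simp add: padic_char_eq_1_iff)
  finally have "(\<Sum>m<CARD('p) ^ (M + L). \<omega> ^ m) = (if \<omega> = 1 then of_nat (CARD('p) ^ (M + L)) else 0)"
    by (simp add: sum_powers_root_of_unity)
  then show ?thesis by (simp only: padic_char_fraction \<omega>_def[symmetric] \<omega>)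
qed

text \<open>Invariance under \<open>p ^ M\<close> gives invariance under its natural multiples. These are dense in
  \<open>p ^ M \<int>\<^sub>p\<close>, so local constancy near \<open>x + h\<close> does the rest.\<close>

lemma test_function_invariant:
  fixes f :: "'p::prime_card padic \<Rightarrow> complex"
  assumes f: "f \<in> test_functions (int M) N" and h: "padic_norm h \<le> real CARD('p) powi (- int M)"
  shows "f (x + h) = f x"
proof -
  have periodic: "f (x + of_nat j * p_pow (int M)) = f x" for j
  proof (induction j)
    case (Suc j)
    have "x + of_nat (Suc j) * p_pow (int M) = (x + of_nat j * p_pow (int M)) + p_pow (int M)"
      by (simp add: distrib_right)
    then show ?case using Suc f unfolding test_functions_def by (simp only: mem_Collect_eq)
  qed simp
  obtain U where U: "open U" "x + h \<in> U" "\<forall>y\<in>U. f y = f (x + h)"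
    using f unfolding test_functions_def by blast
  then obtain r where r: "r > 0" "ball (x + h) r \<subseteq> U" using open_contains_ball by blast
  have "\<forall>\<^sub>F n in sequentially. real CARD('p) powi (- int M - int n) < r"
    using order_tendstoD(2)[OF CARD_powi_tendsto_0 r(1)] .
  then obtain n where n: "real CARD('p) powi (- int M - int n) < r"
    by (auto dest: eventually_happens)
  have "padic_norm (h * p_pow (- int M)) \<le> 1"
    using h padic_norm_mult_p_pow_le_iff[of h "- int M" 0] by simp
  then obtain j where j: "padic_norm (h * p_pow (- int M) - of_nat j) \<le> real CARD('p) powi (- int n)"
    by (rule padic_integer_approx)
  have "(p_pow (- int M) :: 'p padic) * p_pow (int M) = 1"
    using p_pow_mult_inverse[of "int M", where 'p='p] by (simp only: mult.commute)
  then have "(x + h) - (x + of_nat j * p_pow (int M)) = (h * p_pow (- int M) - of_nat j) * p_pow (int M)"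
    by (simp only: left_diff_distrib mult.assoc) simp
  moreover have "int M + (- int M - int n) = - int n" by simp
  ultimately have "padic_norm ((x + h) - (x + of_nat j * p_pow (int M))) \<le> real CARD('p) powi (- int M - int n)"
    using j by (simp only: padic_norm_mult_p_pow_le_iff)
  then have "x + of_nat j * p_pow (int M) \<in> ball (x + h) r"
    using n unfolding mem_ball dist_padic_def by linarith
  then have "f (x + of_nat j * p_pow (int M)) = f (x + h)" using U(3) r(2) by blast
  then show ?thesis by (simp only: periodic)
qed

lemma test_function_support:
  "f \<in> test_functions M N \<Longrightarrow> x \<notin> padic_ball N 0 \<Longrightarrow> f x = 0"
  by (simp add: test_functions_def)

lemma nat_fraction_in_ball: "of_nat j * p_pow (- int L) \<in> padic_ball (int L) (0 :: 'p::prime_card padic)"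
  using padic_norm_mult_p_pow_le_iff[of "of_nat j :: 'p padic" "- int L" "int L"]
    padic_norm_of_nat_le_1[of j, where 'p='p]
  by (simp add: mem_padic_ball_0)

lemma padic_ball_0_mono: "j \<le> k \<Longrightarrow> padic_ball j (0 :: 'p::prime_card padic) \<subseteq> padic_ball k 0"
  using CARD_powi_le_iff[of j k, where 'p='p] by (auto simp: mem_padic_ball_0)

context normalized_haar_measure
begin

lemma fourier_translate:
  assumes "f \<in> borel_measurable \<mu>"
  shows "(\<integral>x. padic_char (\<xi> * x) * f (x - a) \<partial>\<mu>) = padic_char (\<xi> * a) * fourier \<mu> f \<xi>"
proof -
  let ?g = "\<lambda>x. padic_char (\<xi> * x) * f x"
  have g: "?g \<in> borel_measurable \<mu>" using assms measurable_character by measurable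
  have "padic_char (\<xi> * x) * f (x - a) = padic_char (\<xi> * a) * ?g (x + (- a))" for x
  proof -
    have "\<xi> * x = \<xi> * a + \<xi> * (x + (- a))" by (simp add: algebra_simps)
    then have "padic_char (\<xi> * x) = padic_char (\<xi> * a) * padic_char (\<xi> * (x + (- a)))"
      by (simp only: padic_char_add)
    then show ?thesis by simp
  qed
  then have "(\<integral>x. padic_char (\<xi> * x) * f (x - a) \<partial>\<mu>) = (\<integral>x. padic_char (\<xi> * a) * ?g (x + (- a)) \<partial>\<mu>)"
    by (simp only:)
  also have "\<dots> = padic_char (\<xi> * a) * (\<integral>x. ?g (x + (- a)) \<partial>\<mu>)" by simp
  also have "(\<integral>x. ?g (x + (- a)) \<partial>\<mu>) = (\<integral>x. ?g x \<partial>\<mu>)" by (rule integral_translation[OF g])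
  finally show ?thesis by (simp only: fourier_def)
qed

lemma integral_indicator_ball:
  "(\<integral>x. indicator (padic_ball \<gamma> c) x \<partial>\<mu>) = complex_of_real (real CARD('p) powi \<gamma>)"
proof -
  have "(\<integral>x. indicator (padic_ball \<gamma> c) x \<partial>\<mu>) = (\<integral>x. complex_of_real (indicator (padic_ball \<gamma> c) x) \<partial>\<mu>)"
    by (intro Bochner_Integration.integral_cong refl) (simp add: indicator_def)
  also have "\<dots> = complex_of_real (measure \<mu> (padic_ball \<gamma> c))"
    unfolding integral_complex_of_real by (simp add: padic_ball_borel)
  finally show ?thesis by (simp only: measure_ball)
qed

text \<open>On \<open>B\<^sub>L(0)\<close> the function \<open>f\<close> is a function on a finite group, so its Fourier transform can be
  inverted by a finite sum over the dual group.\<close>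

lemma fourier_inversion:
  assumes f: "f \<in> test_functions (int M) (int N)" "integrable \<mu> f"
    and L: "N \<le> L" and x\<^sub>0: "padic_norm x\<^sub>0 \<le> real CARD('p) powi int L"
  shows "(\<Sum>m<CARD('p) ^ (M + L). padic_char (- (of_nat m * p_pow (- int M) * x\<^sub>0))
      * fourier \<mu> f (of_nat m * p_pow (- int M))) = of_nat (CARD('p) ^ L) * f x\<^sub>0"
proof -
  let ?n = "CARD('p) ^ (M + L)"
  define \<xi> where "\<xi> m = (of_nat m * p_pow (- int M) :: 'p padic)" for m
  have kernel: "(\<Sum>m<?n. padic_char (\<xi> m * (x - x\<^sub>0))) * f x
      = of_nat ?n * f x\<^sub>0 * indicator (padic_ball (- int M) x\<^sub>0) x" for x
  proof -
    have near: "f x = f x\<^sub>0" if "padic_norm (x - x\<^sub>0) \<le> real CARD('p) powi (- int M)"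
      using test_function_invariant[OF f(1) that, of x\<^sub>0] by simp
    show ?thesis
    proof (cases "x \<in> padic_ball (int L) 0")
      case True
      then have "padic_norm (x - x\<^sub>0) \<le> real CARD('p) powi int L"
        using x\<^sub>0 by (intro padic_norm_diff_le) (simp_all only: mem_padic_ball_0)
      then show ?thesis
        unfolding \<xi>_def sum_padic_char_fractions[OF \<open>padic_norm (x - x\<^sub>0) \<le> _\<close>]
        using near by (auto simp: padic_ball_def indicator_def)
    next
      case False
      then have "f x = 0"
        using test_function_support[OF f(1)] padic_ball_0_mono[of "int N" "int L", where 'p='p] L by auto
      then show ?thesis using near by (auto simp: padic_ball_def indicator_def)
    qed
  qed
  have "(\<Sum>m<?n. padic_char (- (\<xi> m * x\<^sub>0)) * fourier \<mu> f (\<xi> m))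
      = (\<Sum>m<?n. \<integral>x. padic_char (- (\<xi> m * x\<^sub>0)) * (padic_char (\<xi> m * x) * f x) \<partial>\<mu>)"
    by (simp add: fourier_def)
  also have "\<dots> = (\<integral>x. (\<Sum>m<?n. padic_char (- (\<xi> m * x\<^sub>0)) * (padic_char (\<xi> m * x) * f x)) \<partial>\<mu>)"
    using integrable_character_mult[OF f(2)]
    by (intro Bochner_Integration.integral_sum[symmetric]) simp
  also have "\<dots> = (\<integral>x. of_nat ?n * f x\<^sub>0 * indicator (padic_ball (- int M) x\<^sub>0) x \<partial>\<mu>)"
  proof (intro Bochner_Integration.integral_cong refl)
    fix x
    have "padic_char (- (\<xi> m * x\<^sub>0)) * (padic_char (\<xi> m * x) * f x) = padic_char (\<xi> m * (x - x\<^sub>0)) * f x" for m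
    proof -
      have "\<xi> m * (x - x\<^sub>0) = - (\<xi> m * x\<^sub>0) + \<xi> m * x" by (simp add: right_diff_distrib)
      then show ?thesis by (simp only: padic_char_add mult.assoc)
    qed
    then show "(\<Sum>m<?n. padic_char (- (\<xi> m * x\<^sub>0)) * (padic_char (\<xi> m * x) * f x))
        = of_nat ?n * f x\<^sub>0 * indicator (padic_ball (- int M) x\<^sub>0) x"
      unfolding kernel[symmetric] sum_distrib_right by (simp only:)
  qed
  also have "\<dots> = of_nat ?n * f x\<^sub>0 * of_real (real CARD('p) powi (- int M))"
    by (simp only: integral_indicator_ball Bochner_Integration.integral_mult_right_zero)
  also have "\<dots> = of_nat (CARD('p) ^ L) * f x\<^sub>0"
    by (simp add: power_add power_int_minus)
  finally show ?thesis by (simp only: \<xi>_def)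
qed

end

section \<open>Orthonormal translates force the spectrum into one coset of the integers\<close>

locale orthonormal_band_limited = normalized_haar_measure \<mu>
  for \<mu> :: "'p::prime_card padic measure" +
  fixes S :: "'p padic set" and \<phi> :: "'p padic \<Rightarrow> complex" and M N :: nat
  assumes translate_L2: "a \<in> I_p \<Longrightarrow> (\<lambda>x. \<phi> (x - a)) \<in> L2 \<mu>"
    and translates_orthonormal: "a \<in> I_p \<Longrightarrow> b \<in> I_p \<Longrightarrow>
      L2_inner \<mu> (\<lambda>x. \<phi> (x - a)) (\<lambda>x. \<phi> (x - b)) = (if a = b then 1 else 0)"
    and test_function: "\<phi> \<in> test_functions (int M) (int N)"
    and fourier_indicator: "fourier \<mu> \<phi> \<xi> = indicator S \<xi>"
begin

lemma translate_support:
  assumes "N \<le> L" "a \<in> padic_ball (int L) 0" "x \<notin> padic_ball (int L) 0"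
  shows "\<phi> (x - a) = 0"
proof (rule test_function_support[OF test_function])
  have "x - a \<notin> padic_ball (int L) 0"
    using assms(3) add_in_padic_ball_0_iff[OF assms(2), of "x - a"] by auto
  then show "x - a \<notin> padic_ball (int N) 0"
    using padic_ball_0_mono[of "int N" "int L", where 'p='p] assms(1) by auto
qed

lemma phi_L2: "\<phi> \<in> L2 \<mu>"
  using translate_L2[OF nat_fraction_in_I_p[of 0 0]] by simp

lemma phi_measurable: "\<phi> \<in> borel_measurable \<mu>"
  using phi_L2 by (simp add: L2_def)

lemma phi_integrable: "integrable \<mu> \<phi>"
  using phi_L2 test_function_support[OF test_function] by (rule L2_supported_on_ball_integrable)

text \<open>The truncated character \<open>\<chi>\<^sub>p(-\<xi>\<^sub>0 x)\<close> on \<open>B\<^sub>L(0)\<close> has squared norm \<open>p ^ L\<close>, and its inner product with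
  \<open>\<phi>(\<cdot> - a)\<close>, \<open>a \<in> B\<^sub>L(0)\<close>, is the conjugate of \<open>\<chi>\<^sub>p(\<xi>\<^sub>0 a)\<close> times the value \<open>1\<close> of the Fourier transform of
  \<open>\<phi>\<close> at \<open>\<xi>\<^sub>0\<close>, so it has modulus one. As \<open>B\<^sub>L(0)\<close> contains \<open>p ^ L\<close> elements of \<open>I\<^sub>p\<close>, Bessel's inequality is
  an equality, and the truncated character is a finite combination of translates.\<close>

lemma truncated_character_expansion:
  assumes \<xi>\<^sub>0: "\<xi>\<^sub>0 \<in> S" and L: "N \<le> L"
  defines "a \<equiv> \<lambda>j. of_nat j * p_pow (- int L)"
  shows "AE x in \<mu>. padic_char (- (\<xi>\<^sub>0 * x)) * indicator (padic_ball (int L) 0) x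
    = (\<Sum>j<CARD('p) ^ L. padic_char (- (\<xi>\<^sub>0 * a j)) * \<phi> (x - a j))"
proof -
  let ?n = "CARD('p) ^ L" and ?B = "padic_ball (int L) (0 :: 'p padic)"
  let ?f = "\<lambda>x. padic_char (- (\<xi>\<^sub>0 * x)) * indicator ?B x"
  have aI: "a j \<in> I_p" if "j < ?n" for j
    unfolding a_def using that by (rule nat_fraction_in_I_p)
  have aB: "a j \<in> ?B" for j
    unfolding a_def by (rule nat_fraction_in_ball)
  have inj: "a i = a j \<longleftrightarrow> i = j" for i j by (simp add: a_def)
  have norm_f: "(cmod (?f x))\<^sup>2 = indicator ?B x" for x
    by (simp add: norm_mult indicator_def)
  have meas: "?f \<in> borel_measurable \<mu>"
    using measurable_character[of "- \<xi>\<^sub>0"]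
    by (intro borel_measurable_times borel_measurable_indicator measurable_ball) simp
  have f: "?f \<in> L2 \<mu>"
    unfolding L2_def mem_Collect_eq norm_f using meas integrable_indicator_ball by blast
  have norm: "(L2_norm \<mu> ?f)\<^sup>2 = real ?n"
    unfolding L2_norm_def norm_f by (simp add: measure_ball padic_ball_borel)
  have inner: "L2_inner \<mu> ?f (\<lambda>x. \<phi> (x - a j)) = padic_char (- (\<xi>\<^sub>0 * a j))" for j
  proof -
    have "?f x * cnj (\<phi> (x - a j)) = cnj (padic_char (\<xi>\<^sub>0 * x) * \<phi> (x - a j))" for x
      using translate_support[OF L aB, of x j] by (auto simp: indicator_def cnj_padic_char)
    then have "L2_inner \<mu> ?f (\<lambda>x. \<phi> (x - a j)) = (\<integral>x. cnj (padic_char (\<xi>\<^sub>0 * x) * \<phi> (x - a j)) \<partial>\<mu>)"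
      unfolding L2_inner_def by (simp only:)
    also have "\<dots> = cnj (padic_char (\<xi>\<^sub>0 * a j) * fourier \<mu> \<phi> \<xi>\<^sub>0)"
      unfolding Bochner_Integration.integral_cnj fourier_translate[OF phi_measurable] ..
    finally show ?thesis using \<xi>\<^sub>0 by (simp add: fourier_indicator cnj_padic_char)
  qed
  have "AE x in \<mu>. ?f x = (\<Sum>j\<in>{..<?n}. L2_inner \<mu> ?f (\<lambda>x. \<phi> (x - a j)) * \<phi> (x - a j))"
  proof (rule bessel_equality)
    show "(\<Sum>j<?n. (cmod (L2_inner \<mu> ?f (\<lambda>x. \<phi> (x - a j))))\<^sup>2) = (L2_norm \<mu> ?f)\<^sup>2"
      unfolding inner norm by simp
  qed (use f aI inj in \<open>auto simp: translate_L2 translates_orthonormal\<close>)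
  then show ?thesis unfolding inner .
qed

text \<open>The Fourier transform of the preceding expansion is evaluated at another point \<open>\<xi>\<close> of \<open>S\<close>. On the left,
  it vanishes as soon as \<open>L\<close> is so large that \<open>\<xi>\<close> and \<open>\<xi>\<^sub>0\<close> have distance greater than \<open>p ^ (-L)\<close>. On the right
  it is the geometric sum of \<open>p ^ L\<close> powers of \<open>\<chi>\<^sub>p(p ^ (-L) (\<xi> - \<xi>\<^sub>0))\<close>. If that sum is zero, then the
  \<open>p ^ L\<close>-th power, which is \<open>\<chi>\<^sub>p(\<xi> - \<xi>\<^sub>0)\<close>, equals one.\<close>

lemma spectrum_diff_integral:
  assumes "\<xi> \<in> S" "\<xi>\<^sub>0 \<in> S"
  shows "padic_norm (\<xi> - \<xi>\<^sub>0) \<le> 1"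
proof (cases "\<xi> = \<xi>\<^sub>0")
  case False
  define \<eta> where "\<eta> = \<xi> - \<xi>\<^sub>0"
  have "\<eta> \<noteq> 0" using False by (simp add: \<eta>_def)
  \<comment> \<open>The factor \<open>p ^ (-1)\<close>, of norm \<open>p\<close>, makes the inequality \<open>p ^ (-L) < padic_norm \<eta>\<close> strict.\<close>
  obtain L where L: "padic_norm (inverse \<eta> * p_pow (- 1)) \<le> real CARD('p) ^ L" "N \<le> L"
    by (rule padic_norm_le_p_power)
  have small: "\<not> padic_norm \<eta> \<le> real CARD('p) powi (- int L)"
  proof
    assume le: "padic_norm \<eta> \<le> real CARD('p) powi (- int L)"
    have "0 < padic_norm \<eta>" using \<open>\<eta> \<noteq> 0\<close> padic_norm_eq_0[of \<eta>] padic_norm_nonneg[of \<eta>] by linarith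
    then have "real CARD('p) \<le> real CARD('p) ^ L * padic_norm \<eta>"
      using L(1) unfolding padic_norm_mult padic_norm_inverse padic_norm_p_pow
      by (simp add: field_simps)
    also have "\<dots> \<le> 1" using le by (simp add: power_int_minus field_simps)
    finally show False using real_CARD_prime(1)[where 'p='p] by linarith
  qed
  define a where "a j = (of_nat j * p_pow (- int L) :: 'p padic)" for j
  let ?n = "CARD('p) ^ L" and ?B = "padic_ball (int L) (0 :: 'p padic)"
  have translate_integrable: "integrable \<mu> (\<lambda>x. \<phi> (x - a j))" if "j < ?n" for j
  proof (rule L2_supported_on_ball_integrable)
    show "(\<lambda>x. \<phi> (x - a j)) \<in> L2 \<mu>"
      unfolding a_def using that by (intro translate_L2 nat_fraction_in_I_p)
    have "a j \<in> ?B"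
      unfolding a_def by (rule nat_fraction_in_ball)
    then show "\<phi> (x - a j) = 0" if "x \<notin> ?B" for x
      using translate_support[OF L(2)] that by blast
  qed
  have "(\<Sum>j<?n. padic_char (p_pow (- int L) * \<eta>) ^ j) = (\<Sum>j<?n. padic_char (- (\<xi>\<^sub>0 * a j)) * padic_char (\<xi> * a j))"
  proof (intro sum.cong refl)
    fix j
    have "of_nat j * p_pow (- int L) * \<eta> = - (\<xi>\<^sub>0 * a j) + \<xi> * a j"
      by (simp add: a_def \<eta>_def algebra_simps)
    then show "padic_char (p_pow (- int L) * \<eta>) ^ j = padic_char (- (\<xi>\<^sub>0 * a j)) * padic_char (\<xi> * a j)"
      by (simp only: padic_char_fraction[symmetric] padic_char_add)
  qed
  also have "\<dots> = (\<Sum>j<?n. padic_char (- (\<xi>\<^sub>0 * a j)) * (\<integral>x. padic_char (\<xi> * x) * \<phi> (x - a j) \<partial>\<mu>))"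
    using assms(1) by (simp add: fourier_translate[OF phi_measurable] fourier_indicator)
  also have "\<dots> = (\<Sum>j<?n. \<integral>x. padic_char (- (\<xi>\<^sub>0 * a j)) * (padic_char (\<xi> * x) * \<phi> (x - a j)) \<partial>\<mu>)"
    by simp
  also have "\<dots> = (\<integral>x. (\<Sum>j<?n. padic_char (- (\<xi>\<^sub>0 * a j)) * (padic_char (\<xi> * x) * \<phi> (x - a j))) \<partial>\<mu>)"
    using integrable_character_mult[OF translate_integrable]
    by (intro Bochner_Integration.integral_sum[symmetric]) simp
  also have "\<dots> = (\<integral>x. padic_char (\<eta> * x) * indicator ?B x \<partial>\<mu>)"
  proof (rule integral_cong_AE)
    have "(\<lambda>x. \<phi> (x - a j)) \<in> borel_measurable \<mu>" if "j < ?n" for j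
      using translate_integrable[OF that] by (rule borel_measurable_integrable)
    then show "(\<lambda>x. \<Sum>j<?n. padic_char (- (\<xi>\<^sub>0 * a j)) * (padic_char (\<xi> * x) * \<phi> (x - a j))) \<in> borel_measurable \<mu>"
      using measurable_character by (intro borel_measurable_sum borel_measurable_times) auto
    show "(\<lambda>x. padic_char (\<eta> * x) * indicator ?B x) \<in> borel_measurable \<mu>"
      using measurable_character measurable_ball by measurable
    show "AE x in \<mu>. (\<Sum>j<?n. padic_char (- (\<xi>\<^sub>0 * a j)) * (padic_char (\<xi> * x) * \<phi> (x - a j)))
        = padic_char (\<eta> * x) * indicator ?B x"
      using truncated_character_expansion[OF assms(2) L(2)]
    proof (rule eventually_mono)
      fix x
      assume eq: "padic_char (- (\<xi>\<^sub>0 * x)) * indicator ?B x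
          = (\<Sum>j<?n. padic_char (- (\<xi>\<^sub>0 * (of_nat j * p_pow (- int L)))) * \<phi> (x - of_nat j * p_pow (- int L)))"
      have "\<eta> * x = \<xi> * x + - (\<xi>\<^sub>0 * x)" by (simp add: \<eta>_def algebra_simps)
      then have "padic_char (\<eta> * x) * indicator ?B x = padic_char (\<xi> * x) * (padic_char (- (\<xi>\<^sub>0 * x)) * indicator ?B x)"
        by (simp only: padic_char_add mult.assoc)
      also have "\<dots> = (\<Sum>j<?n. padic_char (- (\<xi>\<^sub>0 * a j)) * (padic_char (\<xi> * x) * \<phi> (x - a j)))"
        unfolding eq sum_distrib_left a_def by (intro sum.cong refl) (simp only: mult.left_commute)
      finally show "(\<Sum>j<?n. padic_char (- (\<xi>\<^sub>0 * a j)) * (padic_char (\<xi> * x) * \<phi> (x - a j)))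
        = padic_char (\<eta> * x) * indicator ?B x" by (rule sym)
    qed
  qed
  also have "\<dots> = 0" using small by (rule integral_character_ball)
  finally have "(\<Sum>j<?n. padic_char (p_pow (- int L) * \<eta>) ^ j) = 0" .
  then have "padic_char (p_pow (- int L) * \<eta>) ^ ?n = 1"
    using power_diff_1_eq[of "padic_char (p_pow (- int L) * \<eta>)" ?n] by simp
  then have "padic_char (of_nat ?n * (p_pow (- int L) * \<eta>)) = 1"
    by (simp only: padic_char_of_nat_mult)
  moreover have "of_nat ?n * (p_pow (- int L) * \<eta>) = \<eta>"
  proof -
    have "(of_nat ?n :: 'p padic) = p_pow (int L)" by simp
    then show ?thesis by (simp only: mult.assoc[symmetric] p_pow_mult_inverse mult_1_left)
  qed
  ultimately show ?thesis by (simp only: padic_char_eq_1_iff \<eta>_def)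
qed simp

lemma spectrum_in_coset:
  obtains \<xi>\<^sub>0 where "\<And>\<xi>. \<xi> \<in> S \<Longrightarrow> padic_norm (\<xi> - \<xi>\<^sub>0) \<le> 1"
proof (cases "S = {}")
  case False
  then show ?thesis using that spectrum_diff_integral by blast
qed (use that in blast)

text \<open>By inversion, \<open>\<phi>\<close> is a combination of the functions \<open>\<chi>\<^sub>p(-\<xi> x)\<close> with \<open>\<xi> \<in> S\<close>, and a translation by an
  integer multiplies all of these by the same factor.\<close>

lemma phi_translate_by_integer:
  assumes coset: "\<And>\<xi>. \<xi> \<in> S \<Longrightarrow> padic_norm (\<xi> - \<xi>\<^sub>0) \<le> 1" and z: "padic_norm z \<le> 1"
  shows "\<phi> (x + z) = padic_char (- (\<xi>\<^sub>0 * z)) * \<phi> x"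
proof -
  obtain L where L: "padic_norm x \<le> real CARD('p) ^ L" "N \<le> L"
    by (rule padic_norm_le_p_power)
  have x: "padic_norm x \<le> real CARD('p) powi int L" using L by simp
  have "1 \<le> real CARD('p) powi int L"
    using CARD_powi_le_iff[of 0 "int L", where 'p='p] by simp
  then have xz: "padic_norm (x + z) \<le> real CARD('p) powi int L"
    using x z by (intro padic_norm_add_le) linarith+
  define \<xi> where "\<xi> m = (of_nat m * p_pow (- int M) :: 'p padic)" for m
  have "padic_char (- (\<xi> m * (x + z))) * fourier \<mu> \<phi> (\<xi> m)
      = padic_char (- (\<xi>\<^sub>0 * z)) * (padic_char (- (\<xi> m * x)) * fourier \<mu> \<phi> (\<xi> m))" for m
  proof (cases "\<xi> m \<in> S")
    case True
    have "padic_norm ((\<xi> m - \<xi>\<^sub>0) * z) \<le> 1 * 1"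
      unfolding padic_norm_mult using coset[OF True] z by (intro mult_mono) (auto simp: padic_norm_nonneg)
    then have 1: "padic_char (- ((\<xi> m - \<xi>\<^sub>0) * z)) = 1"
      by (simp add: padic_char_eq_1_iff padic_norm_minus)
    have "- (\<xi> m * (x + z)) = - (\<xi>\<^sub>0 * z) + (- (\<xi> m * x) + - ((\<xi> m - \<xi>\<^sub>0) * z))"
      by (simp add: algebra_simps)
    then have "padic_char (- (\<xi> m * (x + z))) = padic_char (- (\<xi>\<^sub>0 * z)) * (padic_char (- (\<xi> m * x)) * 1)"
      by (simp only: padic_char_add 1)
    then show ?thesis by simp
  qed (simp add: fourier_indicator)
  then have "of_nat (CARD('p) ^ L) * \<phi> (x + z) = padic_char (- (\<xi>\<^sub>0 * z)) * (of_nat (CARD('p) ^ L) * \<phi> x)"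
    unfolding fourier_inversion[OF test_function phi_integrable L(2) x, symmetric]
      fourier_inversion[OF test_function phi_integrable L(2) xz, symmetric] sum_distrib_left \<xi>_def
    by (simp only:)
  then show ?thesis by simp
qed

end

section \<open>The expansion of a translate\<close>

theorem theorem3p13:
  fixes \<mu> :: "'p::prime_card padic measure"
    and S :: "'p padic set"
    and \<phi> :: "'p padic \<Rightarrow> complex"
    and M N :: nat
  assumes "normalized_haar \<mu>"
    and "scaling_set \<mu> S \<phi>"
    and "\<forall>\<xi>. fourier \<mu> \<phi> \<xi> = indicator S \<xi>"
    and "\<phi> \<in> test_functions (int M) (int N)"
    and "card {n::int. 0 \<le> n \<and> n \<le> int CARD('p) ^ (M + N) - 1 \<and>
             of_int n \<in> (\<lambda>s. of_nat CARD('p) ^ M * s) ` S} \<le> CARD('p) ^ N"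
  shows "\<forall>b.
    (\<exists>\<alpha>. L2_expansion \<mu> I_p (\<lambda>a x. \<phi> (x - a)) \<alpha> (\<lambda>x. \<phi> (x - b))) \<and>
    (\<forall>\<alpha>. L2_expansion \<mu> I_p (\<lambda>a x. \<phi> (x - a)) \<alpha> (\<lambda>x. \<phi> (x - b)) \<longrightarrow>
       (\<forall>\<xi>\<in>S. ((\<lambda>a. \<alpha> a * padic_char ((a - b) * \<xi>)) has_sum 1) I_p))"
proof
  fix b :: "'p padic"
  obtain V where V: "MRA \<mu> V" "scaling_function \<mu> V \<phi>"
    using assms(2) by (auto simp: scaling_set_def)
  have "\<forall>j. closed_L2_subspace \<mu> (V j)"
    using V(1) unfolding MRA_def by (rule conjunct1)
  then have "closed_L2_subspace \<mu> (V 0)" ..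
  then have V0: "V 0 \<subseteq> L2 \<mu>"
    unfolding closed_L2_subspace_def by (rule conjunct1)
  have basis: "orthonormal_basis \<mu> I_p (\<lambda>a x. \<phi> (x - a)) (V 0)"
    using V(2) unfolding scaling_function_def by (rule conjunct2)
  note basis = basis[unfolded orthonormal_basis_def]
  interpret orthonormal_band_limited \<mu> S \<phi> M N
  proof unfold_locales
    show "(\<lambda>x. \<phi> (x - a)) \<in> L2 \<mu>" if "a \<in> I_p" for a
      by (rule subsetD[OF V0 bspec[OF conjunct1[OF basis] that]])
    show "L2_inner \<mu> (\<lambda>x. \<phi> (x - a)) (\<lambda>x. \<phi> (x - b)) = (if a = b then 1 else 0)"
      if "a \<in> I_p" "b \<in> I_p" for a b
      by (rule bspec[OF bspec[OF conjunct1[OF conjunct2[OF basis]] that(1)] that(2)])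
    show "normalized_haar \<mu>" by fact
    show "\<phi> \<in> test_functions (int M) (int N)" by fact
    show "fourier \<mu> \<phi> \<xi> = indicator S \<xi>" for \<xi> using assms(3) ..
  qed
  obtain \<xi>\<^sub>0 where coset: "\<And>\<xi>. \<xi> \<in> S \<Longrightarrow> padic_norm (\<xi> - \<xi>\<^sub>0) \<le> 1"
    using spectrum_in_coset by blast
  \<comment> \<open>The translate by \<open>b\<close> is a multiple of the translate by the representative of \<open>b\<close> in \<open>I\<^sub>p\<close>.\<close>
  define a :: "'p padic" where "a = of_rat (padic_frac b)"
  have a: "a \<in> I_p" unfolding a_def by (rule of_rat_padic_frac_in_I_p)
  have ab: "padic_norm (a - b) \<le> 1"
    using padic_frac(4)[of b] by (simp add: a_def padic_norm_diff_commute)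
  define c where "c = padic_char (- (\<xi>\<^sub>0 * (a - b)))"
  have single: "\<phi> (x - b) = c * \<phi> (x - a)" for x
    using phi_translate_by_integer[OF coset ab, of "x - a"] by (simp add: c_def)
  let ?e = "\<lambda>a x. \<phi> (x - a)" and ?\<beta> = "\<lambda>a'. if a' = a then c else 0"
  have exp: "L2_expansion \<mu> I_p ?e ?\<beta> (\<lambda>x. \<phi> (x - b))"
    using a single by (rule L2_expansion_single)
  have f: "(\<lambda>x. \<phi> (x - b)) \<in> L2 \<mu>"
    unfolding single by (intro L2_scale translate_L2 a)
  have coeff: "\<alpha> a' = L2_inner \<mu> (\<lambda>x. \<phi> (x - b)) (?e a')"
    if "L2_expansion \<mu> I_p ?e \<alpha> (\<lambda>x. \<phi> (x - b))" "a' \<in> I_p" for \<alpha> a'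
    using that(1) f translate_L2 translates_orthonormal that(2) by (rule L2_expansion_coefficient)
  have "((\<lambda>a'. \<alpha> a' * padic_char ((a' - b) * \<xi>)) has_sum 1) I_p"
    if \<alpha>: "L2_expansion \<mu> I_p ?e \<alpha> (\<lambda>x. \<phi> (x - b))" and \<xi>: "\<xi> \<in> S" for \<alpha> \<xi>
  proof -
    have \<beta>: "\<alpha> a' = ?\<beta> a'" if "a' \<in> I_p" for a'
      using coeff[OF \<alpha> that] coeff[OF exp that] by simp
    have "padic_norm ((a - b) * (\<xi> - \<xi>\<^sub>0)) \<le> 1 * 1"
      unfolding padic_norm_mult using coset[OF \<xi>] ab by (intro mult_mono) (auto simp: padic_norm_nonneg)
    then have "padic_char ((a - b) * (\<xi> - \<xi>\<^sub>0)) = 1" by (simp add: padic_char_eq_1_iff)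
    moreover have "(a - b) * (\<xi> - \<xi>\<^sub>0) = - (\<xi>\<^sub>0 * (a - b)) + (a - b) * \<xi>"
      by (simp add: algebra_simps)
    ultimately have "c * padic_char ((a - b) * \<xi>) = 1"
      by (simp only: c_def padic_char_add)
    then have "((\<lambda>a'. \<alpha> a' * padic_char ((a' - b) * \<xi>)) has_sum 1) {a}"
      using has_sum_finite[of "{a}" "\<lambda>a'. \<alpha> a' * padic_char ((a' - b) * \<xi>)"] \<beta>[OF a] by simp
    moreover have "((\<lambda>a'. \<alpha> a' * padic_char ((a' - b) * \<xi>)) has_sum 1) I_p
        \<longleftrightarrow> ((\<lambda>a'. \<alpha> a' * padic_char ((a' - b) * \<xi>)) has_sum 1) {a}"
      by (rule has_sum_cong_neutral) (use a \<beta> in auto)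
    ultimately show ?thesis by (simp only:)
  qed
  with exp show "(\<exists>\<alpha>. L2_expansion \<mu> I_p (\<lambda>a x. \<phi> (x - a)) \<alpha> (\<lambda>x. \<phi> (x - b))) \<and>
    (\<forall>\<alpha>. L2_expansion \<mu> I_p (\<lambda>a x. \<phi> (x - a)) \<alpha> (\<lambda>x. \<phi> (x - b)) \<longrightarrow>
       (\<forall>\<xi>\<in>S. ((\<lambda>a. \<alpha> a * padic_char ((a - b) * \<xi>)) has_sum 1) I_p))"
    by (intro conjI allI impI ballI exI[of _ ?\<beta>])
qed

end
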